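(* Let $\rho>0$ and let $\mathcal{K}$ be a Markov transition on $\mathbb{R}^d$ satisfying the quadratic transportation cost inequality $\mathbb{T}_2(\rho)$. Then for any probability measure $\mu$ on $\mathbb{R}^d$ and any Markov transition $\mathcal{L}$ on $\mathbb{R}^d$ we have $$\mathcal{D}_2(\mu\mathcal{L},\mu\mathcal{K})^2\le \int\mu(dx)\,\mathcal{D}_2(\delta_x\mathcal{L},\delta_x\mathcal{K})^2\le 2\rho\,\mathcal{H}(\mu\times\mathcal{L}\,|\,\mu\times\mathcal{K}).$$ In addition, $$\|m_{\mathcal{K}}-m_{\mathcal{L}}\|_{2,\mu}^2\le 2\rho\,\mathcal{H}(\mu\times\mathcal{L}\,|\,\mu\times\mathcal{K})$$ and $$\|\sigma_{\mathcal{K}}-\sigma_{\mathcal{L}}\|_{1,\mu}\le 4\rho\,\mathcal{H}(\mu\times\mathcal{L}\,|\,\mu\times\mathcal{K})+c_{\mu,\mathcal{L}}\,\bigl(8\rho\,\mathcal{H}(\mu\times\mathcal{L}\,|\,\mu\times\mathcal{K})\bigr)^{1/2},$$ where $c_{\mu,\mathcal{L}}\ge 0$ is defined by $c_{\mu,\mathcal{L}}^2:=\int\mu(dx)\,\mathrm{Tr}(\sigma_{\mathcal{L}}(x))$.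
   Context: Points of $\mathbb{R}^d$ are column vectors and $(\cdot)^{\prime}$ denotes transposition. A Markov transition $\mathcal{K}(x,dy)$ on $\mathbb{R}^d$ is a probability kernel; $\delta_x\mathcal{K}=\mathcal{K}(x,\cdot)$, $(\mu\mathcal{K})(dy)=\int\mu(dx)\mathcal{K}(x,dy)$, and $(\mu\times\mathcal{K})(d(x,y))=\mu(dx)\mathcal{K}(x,dy)$. The conditional mean and conditional covariance are $$m_{\mathcal{K}}(x)=\int\mathcal{K}(x,dy)\,y,\qquad \sigma_{\mathcal{K}}(x)=\int\mathcal{K}(x,dy)\,(y-m_{\mathcal{K}}(x))(y-m_{\mathcal{K}}(x))^{\prime}.$$ In statements involving $m_{\mathcal{L}}$ and $\sigma_{\mathcal{L}}$ these integrals are understood to be well defined for $\mu$-almost every $x$. For probability measures $\mu,\eta$ on $\mathbb{R}^d$, $\Pi(\mu,\eta)$ is the set of probability measures on $\mathbb{R}^d\times\mathbb{R}^d$ with first marginal $\mu$ and second marginal $\eta$, and $\mathcal{D}_2(\mu,\eta)^2=\inf_{P\in\Pi(\mu,\eta)}\int P(d(x,y))\|x-y\|^2\in[0,\infty]$ with $\|\cdot\|$ the Euclidean norm. The relative entropy is $\mathcal{H}(\mu\,|\,\eta)=\int\log(d\mu/d\eta)\,d\mu$ if $\mu\ll\eta$ and $\mathcal{H}(\mu\,|\,\eta)=\infty$ otherwise. For a matrix- (or vector-) valued measurable map $v$ and $p\ge1$, $\|v\|_{p,\mu}^p=\int\mu(dx)\|v(x)\|_F^p$, where $\|v\|_F=\sqrt{\mathrm{Tr}(v^{\prime}v)}$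 is the Frobenius norm (the Euclidean norm for vectors). A probability measure $\mu$ satisfies $\mathbb{T}_2(\rho)$ if $\frac12\mathcal{D}_2(\nu,\mu)^2\le\rho\,\mathcal{H}(\nu\,|\,\mu)$ for every probability measure $\nu$ on $\mathbb{R}^d$. A Markov transition $\mathcal{K}$ satisfies $\mathbb{T}_2(\rho)$ if $\delta_x\mathcal{K}$ satisfies $\mathbb{T}_2(\rho)$ for every $x\in\mathbb{R}^d$. *)

theory Defs
  imports "HOL-Probability.Probability"
begin

abbreviation is_prob :: "('a::topological_space) measure \<Rightarrow> bool" where
  "is_prob \<mu> \<equiv> \<mu> \<in> space (prob_algebra borel)"

abbreviation markov_transition :: "('a::topological_space \<Rightarrow> 'a measure) \<Rightarrow> bool" where
  "markov_transition K \<equiv> K \<in> borel \<rightarrow>\<^sub>M prob_algebra borel"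

text \<open>The measure \<open>\<mu> K\<close> is the monadic bind \<open>\<mu> \<bind> K\<close>, and \<open>\<delta>\<^sub>x K\<close> is just \<open>K x\<close>.
  The measure \<open>\<mu> \<times> K\<close> on pairs is the following.\<close>

definition kernel_prod ::
    "('a::topological_space) measure \<Rightarrow> ('a \<Rightarrow> 'a measure) \<Rightarrow> ('a \<times> 'a) measure" where
  "kernel_prod \<mu> K = \<mu> \<bind> (\<lambda>x. distr (K x) (borel \<Otimes>\<^sub>M borel) (Pair x))"

lemma emeasure_kernel_prod:
  fixes K :: "'a::topological_space \<Rightarrow> 'a measure"
  assumes mu: "is_prob \<mu>" and K: "markov_transition K" and A: "A \<in> sets (borel \<Otimes>\<^sub>M borel)"
  shows "emeasure (kernel_prod \<mu> K) A = (\<integral>\<^sup>+x. (\<integral>\<^sup>+y. indicator A (x, y) \<partial>K x) \<partial>\<mu>)"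
proof -
  have sets_mu: "sets \<mu> = sets borel" and ne: "space \<mu> \<noteq> {}"
    using mu by (auto simp: space_prob_algebra prob_space.not_empty)
  have K': "K \<in> borel \<rightarrow>\<^sub>M subprob_algebra borel"
    using K by (rule measurable_prob_algebraD)
  have "(\<lambda>x. distr (K x) (borel \<Otimes>\<^sub>M borel) (Pair x)) \<in> borel \<rightarrow>\<^sub>M subprob_algebra (borel \<Otimes>\<^sub>M borel)"
    by (rule measurable_distr2[OF _ K']) simp
  then have "(\<lambda>x. distr (K x) (borel \<Otimes>\<^sub>M borel) (Pair x)) \<in> \<mu> \<rightarrow>\<^sub>M subprob_algebra (borel \<Otimes>\<^sub>M borel)"
    by (simp add: measurable_cong_sets[OF sets_mu refl])
  then have "emeasure (kernel_prod \<mu> K) A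
      = (\<integral>\<^sup>+x. emeasure (distr (K x) (borel \<Otimes>\<^sub>M borel) (Pair x)) A \<partial>\<mu>)"
    unfolding kernel_prod_def by (rule emeasure_bind[OF ne _ A])
  also have "\<dots> = (\<integral>\<^sup>+x. (\<integral>\<^sup>+y. indicator A (x, y) \<partial>K x) \<partial>\<mu>)"
  proof (rule nn_integral_cong)
    fix x
    have [measurable_cong]: "sets (K x) = sets borel"
      using K by (auto dest!: measurable_space[of _ _ _ x] simp: space_prob_algebra)
    have *: "Pair x \<in> K x \<rightarrow>\<^sub>M borel \<Otimes>\<^sub>M borel" by measurable
    have "emeasure (distr (K x) (borel \<Otimes>\<^sub>M borel) (Pair x)) A
        = (\<integral>\<^sup>+z. indicator A z \<partial>distr (K x) (borel \<Otimes>\<^sub>M borel) (Pair x))"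
      using A by simp
    also have "\<dots> = (\<integral>\<^sup>+y. indicator A (x, y) \<partial>K x)"
      using A by (intro nn_integral_distr[OF *]) simp
    finally show "emeasure (distr (K x) (borel \<Otimes>\<^sub>M borel) (Pair x)) A
        = (\<integral>\<^sup>+y. indicator A (x, y) \<partial>K x)" .
  qed
  finally show ?thesis .
qed

text \<open>Real powers on \<open>[0,\<infinity>]\<close>; only meant for exponents \<open>a > 0\<close>.\<close>

definition epowr :: "ennreal \<Rightarrow> real \<Rightarrow> ennreal" where
  "epowr x a = (if x = \<infinity> then \<infinity> else ennreal (enn2real x powr a))"

lemma epowr_half_square: "(epowr x (1/2))\<^sup>2 = x"
  by (cases x) (auto simp: epowr_def ennreal_power powr_half_sqrt ennreal_top_mult power2_eq_square
      simp flip: ennreal_mult)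

definition couplings ::
    "('a::topological_space) measure \<Rightarrow> 'a measure \<Rightarrow> ('a \<times> 'a) measure set" where
  "couplings \<mu> \<eta> = {P \<in> space (prob_algebra (borel \<Otimes>\<^sub>M borel)).
     distr P borel fst = \<mu> \<and> distr P borel snd = \<eta>}"

definition D2 :: "('a::real_normed_vector) measure \<Rightarrow> 'a measure \<Rightarrow> ennreal" where
  "D2 \<mu> \<eta> = epowr (INF P \<in> couplings \<mu> \<eta>. \<integral>\<^sup>+(x, y). ennreal ((norm (x - y))\<^sup>2) \<partial>P) (1/2)"

text \<open>Relative entropy \<open>\<H>(\<mu> | \<eta>)\<close>. The integral of \<open>log (d\<mu>/d\<eta>)\<close> with respect to \<open>\<mu>\<close> is
  written as the integral of its positive part minus that of its negative part (\<^const>\<open>ennreal\<close> maps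
  negative reals to 0), so that the value \<open>\<infinity>\<close> is covered. By the lemma below the difference is
  never of the form \<open>\<infinity> - \<infinity>\<close>, and the subtraction of \<^typ>\<open>ennreal\<close> is not truncated.\<close>

definition rel_entropy :: "'a measure \<Rightarrow> 'a measure \<Rightarrow> ennreal" where
  "rel_entropy \<mu> \<eta> =
    (if absolutely_continuous \<eta> \<mu>
     then (\<integral>\<^sup>+x. ennreal (ln (enn2real (RN_deriv \<eta> \<mu> x))) \<partial>\<mu>)
        - (\<integral>\<^sup>+x. ennreal (- ln (enn2real (RN_deriv \<eta> \<mu> x))) \<partial>\<mu>)
     else \<infinity>)"

lemma rel_entropy_well_defined:
  assumes mu: "prob_space \<mu>" and eta: "prob_space \<eta>" and sets: "sets \<mu> = sets \<eta>"
    and ac: "absolutely_continuous \<eta> \<mu>"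
  defines "l \<equiv> \<lambda>x. ln (enn2real (RN_deriv \<eta> \<mu> x))"
  shows "(\<integral>\<^sup>+x. ennreal (- l x) \<partial>\<mu>) \<le> 1"
    and "(\<integral>\<^sup>+x. ennreal (- l x) \<partial>\<mu>) \<le> (\<integral>\<^sup>+x. ennreal (l x) \<partial>\<mu>)"
proof -
  interpret mu: prob_space \<mu> by fact
  interpret eta: prob_space \<eta> by fact
  define r where "r = RN_deriv \<eta> \<mu>"
  have [measurable]: "r \<in> borel_measurable \<eta>" unfolding r_def by simp
  have [measurable]: "r \<in> borel_measurable \<mu>"
    by (subst measurable_cong_sets[OF sets refl]) simp
  have lm [measurable]: "l \<in> borel_measurable \<mu>" unfolding l_def r_def[symmetric] by measurable
  have fin: "AE x in \<mu>. r x \<noteq> \<infinity>"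
    unfolding r_def
    by (rule absolutely_continuous_AE[OF sets ac]) (rule eta.RN_deriv_finite[OF _ ac sets], unfold_locales)
  have "(\<integral>\<^sup>+x. indicator {x \<in> space \<eta>. r x = 0} x \<partial>\<mu>)
      = (\<integral>\<^sup>+x. r x * indicator {x \<in> space \<eta>. r x = 0} x \<partial>\<eta>)"
    unfolding r_def by (rule eta.RN_deriv_nn_integral[OF ac sets]) (simp flip: r_def)
  also have "\<dots> = (\<integral>\<^sup>+x. 0 \<partial>\<eta>)"
    by (intro nn_integral_cong) (auto split: split_indicator)
  finally have "emeasure \<mu> {x \<in> space \<eta>. r x = 0} = 0"
    by (subst (asm) nn_integral_indicator) (auto simp: sets)
  then have pos: "AE x in \<mu>. r x \<noteq> 0"
    by (intro AE_I[of _ _ "{x \<in> space \<eta>. r x = 0}"]) (auto simp: sets sets_eq_imp_space_eq[OF sets])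
  have "(\<integral>\<^sup>+x. inverse (r x) \<partial>\<mu>) = (\<integral>\<^sup>+x. r x * inverse (r x) \<partial>\<eta>)"
    unfolding r_def by (rule eta.RN_deriv_nn_integral[OF ac sets]) simp
  also have "\<dots> \<le> (\<integral>\<^sup>+x. 1 \<partial>\<eta>)"
  proof (rule nn_integral_mono)
    fix x
    show "r x * inverse (r x) \<le> 1"
    proof (cases "r x = 0 \<or> r x = \<infinity>")
      case False
      then have "r x = ennreal (enn2real (r x))" "enn2real (r x) > 0"
        by (auto simp: enn2real_positive_iff less_top zero_less_iff_neq_zero)
      then obtain t where "r x = ennreal t" "t > 0" by blast
      then show ?thesis by (simp add: inverse_ennreal flip: ennreal_mult)
    qed auto
  qed
  also have "\<dots> = 1" by (simp add: eta.emeasure_space_1)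
  finally have inv: "(\<integral>\<^sup>+x. inverse (r x) \<partial>\<mu>) \<le> 1" .
  have pt: "ennreal (- l x) \<le> inverse (r x) \<and> ennreal (- l x) + 1 \<le> ennreal (l x) + inverse (r x)"
    if "r x \<noteq> 0" "r x \<noteq> \<infinity>" for x
  proof -
    define t where "t = enn2real (r x)"
    have t: "r x = ennreal t" "t > 0" "l x = ln t"
      using that by (auto simp: t_def l_def enn2real_positive_iff less_top zero_less_iff_neq_zero
          simp flip: r_def)
    have ir: "inverse (r x) = ennreal (inverse t)" using t by (simp add: inverse_ennreal)
    have le: "- ln t \<le> inverse t - 1"
      using ln_le_minus_one[of "inverse t"] t by (simp add: ln_inverse)
    have 1: "ennreal (- l x) \<le> inverse (r x)"
      unfolding ir using le t by (intro ennreal_leI) simp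
    have "ennreal (- l x) + 1 \<le> ennreal (l x) + inverse (r x)"
    proof (cases "ln t \<ge> 0")
      case True
      then have "ennreal (- l x) + 1 = ennreal 1" using t by (simp add: ennreal_neg)
      also have "\<dots> \<le> ennreal (ln t + inverse t)" using le by (intro ennreal_leI) simp
      also have "\<dots> = ennreal (l x) + inverse (r x)"
        using True t ir by (subst ennreal_plus) auto
      finally show ?thesis .
    next
      case False
      then have "ennreal (- l x) + 1 = ennreal (- ln t + 1)"
        using t by (subst ennreal_plus) (auto simp: not_le)
      also have "\<dots> \<le> ennreal (inverse t)" using le by (intro ennreal_leI) simp
      also have "\<dots> = ennreal (l x) + inverse (r x)" using False t ir by (simp add: ennreal_neg)
      finally show ?thesis .
    qed
    with 1 show ?thesis by simp
  qed
  have pt_AE: "AE x in \<mu>. ennreal (- l x) \<le> inverse (r x)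
      \<and> ennreal (- l x) + 1 \<le> ennreal (l x) + inverse (r x)"
    using pos fin by eventually_elim (rule pt)
  have "(\<integral>\<^sup>+x. ennreal (- l x) \<partial>\<mu>) \<le> (\<integral>\<^sup>+x. inverse (r x) \<partial>\<mu>)"
    using pt_AE by (intro nn_integral_mono_AE) (elim eventually_mono, simp)
  with inv show "(\<integral>\<^sup>+x. ennreal (- l x) \<partial>\<mu>) \<le> 1" by simp
  have "(\<integral>\<^sup>+x. ennreal (- l x) \<partial>\<mu>) + 1 = (\<integral>\<^sup>+x. ennreal (- l x) + 1 \<partial>\<mu>)"
    by (subst nn_integral_add) (auto simp: mu.emeasure_space_1)
  also have "\<dots> \<le> (\<integral>\<^sup>+x. ennreal (l x) + inverse (r x) \<partial>\<mu>)"
    using pt_AE by (intro nn_integral_mono_AE) (elim eventually_mono, simp)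
  also have "\<dots> = (\<integral>\<^sup>+x. ennreal (l x) \<partial>\<mu>) + (\<integral>\<^sup>+x. inverse (r x) \<partial>\<mu>)"
    by (rule nn_integral_add) auto
  also have "\<dots> \<le> (\<integral>\<^sup>+x. ennreal (l x) \<partial>\<mu>) + 1"
    using inv by (rule add_left_mono)
  finally show "(\<integral>\<^sup>+x. ennreal (- l x) \<partial>\<mu>) \<le> (\<integral>\<^sup>+x. ennreal (l x) \<partial>\<mu>)"
    by (simp add: add.commute)
qed

definition transport_T2 :: "real \<Rightarrow> ('a::real_normed_vector) measure \<Rightarrow> bool" where
  "transport_T2 \<rho> \<mu> \<longleftrightarrow>
    (\<forall>\<nu>. is_prob \<nu> \<longrightarrow> (D2 \<nu> \<mu>)\<^sup>2 / 2 \<le> ennreal \<rho> * rel_entropy \<nu> \<mu>)"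

definition kernel_T2 :: "real \<Rightarrow> ('a::real_normed_vector \<Rightarrow> 'a measure) \<Rightarrow> bool" where
  "kernel_T2 \<rho> K \<longleftrightarrow> (\<forall>x. transport_T2 \<rho> (K x))"

definition outer :: "real^'d \<Rightarrow> real^'d \<Rightarrow> real^'d^'d" where
  "outer v w = (\<chi> i j. v $ i * w $ j)"

definition cond_mean :: "(real^'d \<Rightarrow> (real^'d) measure) \<Rightarrow> real^'d \<Rightarrow> real^'d" where
  "cond_mean K x = (\<integral>y. y \<partial>K x)"

definition cond_cov :: "(real^'d \<Rightarrow> (real^'d) measure) \<Rightarrow> real^'d \<Rightarrow> real^'d^'d" where
  "cond_cov K x = (\<integral>y. outer (y - cond_mean K x) (y - cond_mean K x) \<partial>K x)"

definition mean_well_defined :: "(real^'d \<Rightarrow> (real^'d) measure) \<Rightarrow> real^'d \<Rightarrow> bool" where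
  "mean_well_defined K x \<longleftrightarrow> integrable (K x) (\<lambda>y. y)"

definition cov_well_defined :: "(real^'d \<Rightarrow> (real^'d) measure) \<Rightarrow> real^'d \<Rightarrow> bool" where
  "cov_well_defined K x \<longleftrightarrow>
    integrable (K x) (\<lambda>y. outer (y - cond_mean K x) (y - cond_mean K x))"

text \<open>The norm of the type of matrices is the Frobenius norm, so the following definition
  covers both vector- and matrix-valued maps.\<close>

lemma norm_matrix_eq_frobenius:
  fixes A :: "real^'n^'m"
  shows "norm A = sqrt (trace (transpose A ** A))"
proof -
  have "trace (transpose A ** A) = (\<Sum>j\<in>UNIV. \<Sum>i\<in>UNIV. (A $ i $ j)\<^sup>2)"
    by (simp add: trace_def matrix_matrix_mult_def transpose_def power2_eq_square)
  also have "\<dots> = (\<Sum>i\<in>UNIV. \<Sum>j\<in>UNIV. (A $ i $ j)\<^sup>2)"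
    by (rule sum.swap)
  finally show ?thesis
    by (simp add: norm_vec_def L2_set_def sum_nonneg)
qed

definition Lp_norm :: "real \<Rightarrow> 'a measure \<Rightarrow> ('a \<Rightarrow> 'b::real_normed_vector) \<Rightarrow> ennreal" where
  "Lp_norm p \<mu> v = epowr (\<integral>\<^sup>+x. ennreal (norm (v x) powr p) \<partial>\<mu>) (1/p)"

definition c_const :: "(real^'d) measure \<Rightarrow> (real^'d \<Rightarrow> (real^'d) measure) \<Rightarrow> ennreal" where
  "c_const \<mu> L = epowr (\<integral>\<^sup>+x. ennreal (trace (cond_cov L x)) \<partial>\<mu>) (1/2)"

end

theory Submission
  imports Defs
begin

text \<open>
  The theorem rests on three facts: the transport cost is subadditive under mixtures, relative
  entropy is additive over fibres, and two measures with a cheap coupling have close means and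
  covariances.

  \<^emph>\<open>Mixtures.\<close> If \<open>P\<^sub>x\<close> couples \<open>L x\<close> and \<open>K x\<close> and depends measurably on \<open>x\<close>, then the mixture of
  the \<open>P\<^sub>x\<close> under \<open>\<mu>\<close> couples \<open>\<mu>L\<close> and \<open>\<mu>K\<close>, and its cost is the average of the costs. The
  first inequality therefore needs a measurable choice of nearly optimal couplings, and the whole
  difficulty lies there. Instead of a general selection theorem, one countable family
  of constructions is used that serves all pairs of measures at once: an element of the family is a
  step function \<open>f(y,z)\<close> on pairs of cells of a fine partition, with rational values; it is read as
  a density with respect to \<open>L x \<otimes> K x\<close>, and the mass that its margins miss is filled in by a
  product measure (\<open>completed_coupling\<close>). Each such coupling is measurable in \<open>x\<close>. If both
  measures have finite second moments, then the infimum of the costs over the family is the optimal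
  cost (\<open>step_couplings_near_optimal\<close>): smooth a coupling over the cells, then round
  finitely many of the values down; the mass that is lost has vanishing second moment, and
  this is why the product filling is harmless. Taking the first member of the family that is within
  \<open>\<epsilon>\<close> of the infimum is a measurable choice (\<open>D2_bind_le\<close>). The second moments are
  finite for \<open>K x\<close> because of \<open>T\<^sub>2\<close>, applied to \<open>K x\<close> conditioned on a ball
  (\<open>transport_T2_second_moment\<close>), and hence for \<open>L x\<close> whenever the transport cost is finite;
  where it is infinite on a set of positive measure, the bound is trivial.

  \<^emph>\<open>Entropy.\<close> If \<open>r\<close> is the density of \<open>\<mu> \<times> L\<close> with respect to \<open>\<mu> \<times> K\<close>, then
  \<open>r(x,\<cdot>)\<close> is the density of \<open>L x\<close> with respect to \<open>K x\<close> for almost every \<open>x\<close>, because the Borel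
  sets have a countable generator. Integrating \<open>ln r\<close> fibre by fibre gives the chain rule
  (\<open>rel_entropy_chain_rule\<close>), and \<open>T\<^sub>2\<close> in each fibre gives the second inequality.

  \<^emph>\<open>Moments.\<close> Let \<open>(Y,Z)\<close> be distributed according to a coupling of \<open>L x\<close> and \<open>K x\<close>. The
  difference of the means is the expectation of \<open>Z - Y\<close>, so Jensen's inequality bounds it. For the
  covariances put \<open>U = Y - E Y\<close>, \<open>V = Z - E Z\<close> and \<open>W = V - U\<close>; then
  \<open>VV' - UU' = WW' + UW' + WU'\<close>, and the Cauchy-Schwarz inequality bounds the norm of the expectation
  by \<open>E|W|\<^sup>2 + 2 (E|U|\<^sup>2 E|W|\<^sup>2)\<^sup>1\<^sup>/\<^sup>2\<close> with \<open>E|W|\<^sup>2 \<le> E|Z - Y|\<^sup>2\<close>. A second use of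
  Cauchy-Schwarz, now in \<open>x\<close>, gives the integrated bound, even with \<open>2\<rho>\<close> in place of
  \<open>4\<rho>\<close> in the linear term.
\<close>

section \<open>Couplings, second moments and conditioning\<close>

lemma is_probD:
  assumes "is_prob \<mu>"
  shows "prob_space \<mu>" "sets \<mu> = sets borel" "space \<mu> = UNIV"
  using assms sets_eq_imp_space_eq[of \<mu> borel] by (auto simp: space_prob_algebra)

lemma markov_transitionD:
  assumes "markov_transition K"
  shows "is_prob (K x)"
  using measurable_space[OF assms, of x] by simp

abbreviation sq_cost :: "('a::real_normed_vector \<times> 'a) measure \<Rightarrow> ennreal" where
  "sq_cost P \<equiv> \<integral>\<^sup>+(x, y). ennreal ((norm (x - y))\<^sup>2) \<partial>P"

abbreviation second_moment :: "'a::real_normed_vector measure \<Rightarrow> ennreal" where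
  "second_moment \<mu> \<equiv> \<integral>\<^sup>+x. ennreal ((norm x)\<^sup>2) \<partial>\<mu>"

lemma D2_squared: "(D2 \<mu> \<eta>)\<^sup>2 = (INF P \<in> couplings \<mu> \<eta>. sq_cost P)"
  unfolding D2_def by (rule epowr_half_square)

lemma couplingsD:
  assumes "P \<in> couplings \<mu> \<eta>"
  shows "prob_space P" "sets P = sets (borel \<Otimes>\<^sub>M borel)"
    "distr P borel fst = \<mu>" "distr P borel snd = \<eta>"
  using assms by (auto simp: couplings_def space_prob_algebra)

lemma coupling_nn_integral:
  assumes P: "P \<in> couplings \<mu> \<eta>" and f: "f \<in> borel_measurable borel"
  shows "(\<integral>\<^sup>+z. f (fst z) \<partial>P) = (\<integral>\<^sup>+x. f x \<partial>\<mu>)"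
    and "(\<integral>\<^sup>+z. f (snd z) \<partial>P) = (\<integral>\<^sup>+x. f x \<partial>\<eta>)"
proof -
  note [measurable_cong] = couplingsD(2)[OF P]
  show "(\<integral>\<^sup>+z. f (fst z) \<partial>P) = (\<integral>\<^sup>+x. f x \<partial>\<mu>)"
    using f by (subst couplingsD(3)[OF P, symmetric]) (simp add: nn_integral_distr)
  show "(\<integral>\<^sup>+z. f (snd z) \<partial>P) = (\<integral>\<^sup>+x. f x \<partial>\<eta>)"
    using f by (subst couplingsD(4)[OF P, symmetric]) (simp add: nn_integral_distr)
qed

lemma norm_diff_squared_le:
  fixes a b :: "'a::real_normed_vector"
  shows "(norm (a - b))\<^sup>2 \<le> 2 * (norm a)\<^sup>2 + 2 * (norm b)\<^sup>2"
proof -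
  have "(norm (a - b))\<^sup>2 \<le> (norm a + norm b)\<^sup>2"
    by (intro power_mono norm_triangle_ineq4) auto
  also have "\<dots> \<le> 2 * (norm a)\<^sup>2 + 2 * (norm b)\<^sup>2"
    using sum_squares_bound[of "norm a" "norm b"] by (simp add: power2_sum)
  finally show ?thesis .
qed

lemma ennreal_norm_diff_squared_le:
  fixes a b :: "'a::real_normed_vector"
  shows "ennreal ((norm (a - b))\<^sup>2) \<le> 2 * ennreal ((norm a)\<^sup>2) + 2 * ennreal ((norm b)\<^sup>2)"
proof -
  have "ennreal ((norm (a - b))\<^sup>2) \<le> ennreal (2 * (norm a)\<^sup>2 + 2 * (norm b)\<^sup>2)"
    by (intro ennreal_leI norm_diff_squared_le)
  then show ?thesis by (simp add: ennreal_mult)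
qed

lemma second_moment_coupling:
  fixes \<mu> \<eta> :: "'a::{real_normed_vector, second_countable_topology} measure"
  assumes P: "P \<in> couplings \<mu> \<eta>"
  shows "second_moment \<mu> \<le> 2 * sq_cost P + 2 * second_moment \<eta>"
    and "second_moment \<eta> \<le> 2 * sq_cost P + 2 * second_moment \<mu>"
proof -
  note [measurable_cong] = couplingsD(2)[OF P]
  have "second_moment \<mu> = (\<integral>\<^sup>+z. ennreal ((norm (fst z))\<^sup>2) \<partial>P)"
    by (rule coupling_nn_integral(1)[OF P, symmetric]) measurable
  also have "\<dots> \<le> (\<integral>\<^sup>+z. 2 * ennreal ((norm (fst z - snd z))\<^sup>2) + 2 * ennreal ((norm (snd z))\<^sup>2) \<partial>P)"
    using ennreal_norm_diff_squared_le[of "fst z - snd z" "- snd z" for z :: "'a \<times> 'a"]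
    by (intro nn_integral_mono) simp
  also have "\<dots> = 2 * sq_cost P + 2 * (\<integral>\<^sup>+z. ennreal ((norm (snd z))\<^sup>2) \<partial>P)"
    by (simp add: nn_integral_add nn_integral_cmult case_prod_unfold)
  also have "(\<integral>\<^sup>+z. ennreal ((norm (snd z))\<^sup>2) \<partial>P) = second_moment \<eta>"
    by (rule coupling_nn_integral(2)[OF P]) measurable
  finally show "second_moment \<mu> \<le> 2 * sq_cost P + 2 * second_moment \<eta>" .
  have "second_moment \<eta> = (\<integral>\<^sup>+z. ennreal ((norm (snd z))\<^sup>2) \<partial>P)"
    by (rule coupling_nn_integral(2)[OF P, symmetric]) measurable
  also have "\<dots> \<le> (\<integral>\<^sup>+z. 2 * ennreal ((norm (fst z - snd z))\<^sup>2) + 2 * ennreal ((norm (fst z))\<^sup>2) \<partial>P)"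
    using ennreal_norm_diff_squared_le[of "fst z - snd z" "fst z" for z :: "'a \<times> 'a"]
    by (intro nn_integral_mono) simp
  also have "\<dots> = 2 * sq_cost P + 2 * (\<integral>\<^sup>+z. ennreal ((norm (fst z))\<^sup>2) \<partial>P)"
    by (simp add: nn_integral_add nn_integral_cmult case_prod_unfold)
  also have "(\<integral>\<^sup>+z. ennreal ((norm (fst z))\<^sup>2) \<partial>P) = second_moment \<mu>"
    by (rule coupling_nn_integral(1)[OF P]) measurable
  finally show "second_moment \<eta> \<le> 2 * sq_cost P + 2 * second_moment \<mu>" .
qed

text \<open>Along a coupling, \<open>\<bar>y\<bar>\<^sup>2 \<le> 2\<bar>y - z\<bar>\<^sup>2 + 2\<bar>z\<bar>\<^sup>2\<close> and vice versa, so a finite cost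
  transfers finiteness of the second moment in both directions.\<close>
lemma second_moment_finite_if_D2_finite:
  fixes \<mu> \<eta> :: "'a::{real_normed_vector, second_countable_topology} measure"
  assumes D: "(D2 \<mu> \<eta>)\<^sup>2 < \<infinity>" and fin: "second_moment \<eta> < \<infinity> \<or> second_moment \<mu> < \<infinity>"
  shows "second_moment \<mu> < \<infinity>" "second_moment \<eta> < \<infinity>"
proof -
  obtain P where P: "P \<in> couplings \<mu> \<eta>" and c: "sq_cost P < \<infinity>"
    using D by (auto simp: D2_squared INF_less_iff)
  have "second_moment \<mu> < \<infinity> \<longleftrightarrow> second_moment \<eta> < \<infinity>"
  proof
    assume "second_moment \<mu> < \<infinity>"
    with c have "2 * sq_cost P + 2 * second_moment \<mu> < \<infinity>" by (simp add: ennreal_mult_less_top)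
    with second_moment_coupling(2)[OF P] show "second_moment \<eta> < \<infinity>" by (rule le_less_trans)
  next
    assume "second_moment \<eta> < \<infinity>"
    with c have "2 * sq_cost P + 2 * second_moment \<eta> < \<infinity>" by (simp add: ennreal_mult_less_top)
    with second_moment_coupling(1)[OF P] show "second_moment \<mu> < \<infinity>" by (rule le_less_trans)
  qed
  with fin show "second_moment \<mu> < \<infinity>" "second_moment \<eta> < \<infinity>" by auto
qed

text \<open>The density of the conditional measure is the constant \<open>1 / M A\<close> on \<open>A\<close>, so its logarithm is
  bounded there.\<close>
lemma rel_entropy_conditioning_finite:
  assumes "prob_space M" and A: "A \<in> sets M" "emeasure M A \<noteq> 0"
  shows "rel_entropy (uniform_measure M A) M < \<infinity>"
proof -
  interpret prob_space M by fact
  define p where "p = measure M A"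
  have p: "p > 0" "emeasure M A = ennreal p"
    using A by (auto simp: p_def emeasure_eq_measure zero_less_measure_iff)
  let ?\<nu> = "uniform_measure M A"
  have ac: "absolutely_continuous M ?\<nu>"
    unfolding uniform_measure_def by (intro absolutely_continuousI_density) (use A in measurable)
  interpret nu: prob_space ?\<nu>
    by (rule prob_space_uniform_measure) (use A in auto)
  have "AE x in M. indicator A x / emeasure M A = RN_deriv M ?\<nu> x"
    by (rule RN_deriv_unique) (use A in \<open>auto simp: uniform_measure_def\<close>)
  then have "AE x in ?\<nu>. indicator A x / emeasure M A = RN_deriv M ?\<nu> x"
    by (rule absolutely_continuous_AE[OF sets_uniform_measure ac])
  then have AE: "AE x in ?\<nu>. ennreal (ln (enn2real (RN_deriv M ?\<nu> x))) \<le> ennreal \<bar>ln (1 / p)\<bar>"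
  proof eventually_elim
    case (elim x)
    have "indicator A x / emeasure M A = ennreal (indicator A x / p)"
      using p by (cases "x \<in> A") (simp_all add: divide_ennreal flip: ennreal_1)
    then have "enn2real (RN_deriv M ?\<nu> x) = indicator A x / p"
      using p by (simp flip: elim)
    then show ?case by (intro ennreal_leI) (auto split: split_indicator)
  qed
  have "rel_entropy ?\<nu> M \<le> (\<integral>\<^sup>+x. ennreal (ln (enn2real (RN_deriv M ?\<nu> x))) \<partial>?\<nu>)"
    unfolding rel_entropy_def using ac by simp
  also have "\<dots> \<le> (\<integral>\<^sup>+x. ennreal \<bar>ln (1 / p)\<bar> \<partial>?\<nu>)"
    by (rule nn_integral_mono_AE[OF AE])
  also have "\<dots> < \<infinity>" using nu.emeasure_space_1 by (simp add: ennreal_mult_less_top)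
  finally show ?thesis .
qed

text \<open>Condition \<open>\<eta>\<close> on a ball of positive mass: the result has finite entropy and bounded support,
  so \<open>T\<^sub>2\<close> puts it at finite distance from \<open>\<eta>\<close>, and second moments pass along a
  coupling of finite cost.\<close>
lemma transport_T2_second_moment:
  fixes \<eta> :: "'a::{real_normed_vector, second_countable_topology} measure"
  assumes T2: "transport_T2 \<rho> \<eta>" and eta: "is_prob \<eta>"
  shows "second_moment \<eta> < \<infinity>"
proof -
  interpret prob_space \<eta> by (rule is_probD(1)[OF eta])
  note [measurable_cong] = is_probD(2)[OF eta]
  have "\<exists>n::nat. emeasure \<eta> (cball 0 n) \<noteq> 0"
  proof (rule ccontr)
    assume "\<not> ?thesis"
    then have "emeasure \<eta> (\<Union>n::nat. cball 0 (real n)) = 0"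
      by (intro emeasure_UN_eq_0) (auto simp: is_probD(2)[OF eta])
    moreover have "(\<Union>n::nat. cball 0 (real n)) = (UNIV :: 'a set)"
      by (auto simp: real_arch_simple)
    ultimately show False
      using emeasure_space_1 is_probD(3)[OF eta] by simp
  qed
  then obtain n :: nat where n: "emeasure \<eta> (cball 0 n) \<noteq> 0" by blast
  have B: "cball 0 (real n) \<in> sets \<eta>" by (simp add: is_probD(2)[OF eta])
  define \<nu> where "\<nu> = uniform_measure \<eta> (cball 0 (real n))"
  have "prob_space \<nu>" unfolding \<nu>_def
    by (rule prob_space_uniform_measure) (use n B in auto)
  then have nu: "is_prob \<nu>"
    by (auto simp: space_prob_algebra \<nu>_def is_probD(2)[OF eta])
  interpret nu: prob_space \<nu> by fact
  have "(D2 \<nu> \<eta>)\<^sup>2 / 2 \<le> ennreal \<rho> * rel_entropy \<nu> \<eta>"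
    using T2 nu unfolding transport_T2_def by blast
  also have "\<dots> < \<infinity>"
    unfolding \<nu>_def using rel_entropy_conditioning_finite[OF prob_space_axioms B n]
    by (simp add: ennreal_mult_less_top)
  finally have D: "(D2 \<nu> \<eta>)\<^sup>2 < \<infinity>"
    by (cases "(D2 \<nu> \<eta>)\<^sup>2") (auto simp: ennreal_top_divide)
  have "AE x in \<nu>. x \<in> cball 0 (real n)"
    unfolding \<nu>_def by (rule AE_uniform_measureI[OF B]) auto
  then have "second_moment \<nu> \<le> (\<integral>\<^sup>+x. ennreal ((real n)\<^sup>2) \<partial>\<nu>)"
    by (intro nn_integral_mono_AE) (auto elim!: eventually_mono intro!: ennreal_leI power_mono)
  also have "\<dots> < \<infinity>" by (simp add: nu.emeasure_space_1)
  finally show ?thesis using second_moment_finite_if_D2_finite(2)[OF D] by blast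
qed

section \<open>Completing a sub-coupling to a coupling\<close>

text \<open>A function \<open>f\<close> on pairs is read as a density with respect to the product \<open>A \<otimes> B\<close>; the following
  are the densities of its two margins with respect to \<open>A\<close> and \<open>B\<close>.\<close>
definition fst_margin :: "'b measure \<Rightarrow> ('a \<times> 'b \<Rightarrow> ennreal) \<Rightarrow> 'a \<Rightarrow> ennreal" where
  "fst_margin B f y = (\<integral>\<^sup>+z. f (y, z) \<partial>B)"

definition snd_margin :: "'a measure \<Rightarrow> ('a \<times> 'b \<Rightarrow> ennreal) \<Rightarrow> 'b \<Rightarrow> ennreal" where
  "snd_margin A f z = (\<integral>\<^sup>+y. f (y, z) \<partial>A)"

text \<open>The condition says that both marginal densities are at most 1 almost everywhere. It is written
  with the truncated difference of extended nonnegative reals, so that for kernels its dependence on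
  the base point is visibly measurable.\<close>
definition subcoupling :: "'a measure \<Rightarrow> 'b measure \<Rightarrow> ('a \<times> 'b \<Rightarrow> ennreal) \<Rightarrow> bool" where
  "subcoupling A B f \<longleftrightarrow>
     (\<integral>\<^sup>+y. fst_margin B f y - 1 \<partial>A) = 0 \<and> (\<integral>\<^sup>+z. snd_margin A f z - 1 \<partial>B) = 0"

text \<open>The mass missing in the two margins is added as a product measure, normalised by the
  total missing mass, so that both margins become full. If nothing is missing, the quotient is
  \<open>0 / 0 = 0\<close> almost everywhere. When \<open>f\<close> is not a sub-coupling the product measure is used, so that
  every \<open>f\<close> yields a coupling.\<close>
definition completed_density ::
    "'a measure \<Rightarrow> 'b measure \<Rightarrow> ('a \<times> 'b \<Rightarrow> ennreal) \<Rightarrow> 'a \<times> 'b \<Rightarrow> ennreal" where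
  "completed_density A B f w =
     (if subcoupling A B f
      then f w + (1 - fst_margin B f (fst w)) * (1 - snd_margin A f (snd w))
                   / (1 - (\<integral>\<^sup>+y. fst_margin B f y \<partial>A))
      else 1)"

definition completed_coupling ::
    "'a measure \<Rightarrow> 'b measure \<Rightarrow> ('a \<times> 'b \<Rightarrow> ennreal) \<Rightarrow> ('a \<times> 'b) measure" where
  "completed_coupling A B f = density (A \<Otimes>\<^sub>M B) (completed_density A B f)"

lemma AE_le_one_iff:
  assumes [measurable]: "g \<in> borel_measurable M"
  shows "(\<integral>\<^sup>+y. g y - 1 \<partial>M) = (0 :: ennreal) \<longleftrightarrow> (AE y in M. g y \<le> 1)"
proof -
  have "a - 1 = 0 \<longleftrightarrow> a \<le> 1" for a :: ennreal
    by (auto simp: diff_eq_0_iff_ennreal intro: le_less_trans[OF _ ennreal_one_less_top])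
  then show ?thesis by (subst nn_integral_0_iff_AE) auto
qed

context
  fixes A :: "'a measure" and B :: "'b measure" and f :: "'a \<times> 'b \<Rightarrow> ennreal"
  assumes A: "prob_space A" and B: "prob_space B" and f [measurable]: "f \<in> borel_measurable (A \<Otimes>\<^sub>M B)"
begin

interpretation A: prob_space A by (fact A)
interpretation B: prob_space B by (fact B)
interpretation AB: pair_prob_space A B ..

lemma fst_margin_measurable [measurable]: "fst_margin B f \<in> borel_measurable A"
  unfolding fst_margin_def by measurable

lemma snd_margin_measurable [measurable]: "snd_margin A f \<in> borel_measurable B"
  unfolding snd_margin_def by measurable

lemma completed_density_measurable [measurable]:
  "completed_density A B f \<in> borel_measurable (A \<Otimes>\<^sub>M B)"
  unfolding completed_density_def[abs_def] by measurable

lemma margins_same_mass: "(\<integral>\<^sup>+y. fst_margin B f y \<partial>A) = (\<integral>\<^sup>+z. snd_margin A f z \<partial>B)"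
  unfolding fst_margin_def snd_margin_def by (rule AB.Fubini'[symmetric]) simp

lemma subcoupling_margins_le:
  assumes "subcoupling A B f"
  shows "AE y in A. fst_margin B f y \<le> 1" "AE z in B. snd_margin A f z \<le> 1"
  using assms unfolding subcoupling_def by (simp_all add: AE_le_one_iff)

lemma subcoupling_defects:
  assumes "subcoupling A B f"
  defines "s \<equiv> (\<integral>\<^sup>+y. fst_margin B f y \<partial>A)"
  shows "s \<le> 1"
    and "(\<integral>\<^sup>+y. 1 - fst_margin B f y \<partial>A) = 1 - s"
    and "(\<integral>\<^sup>+z. 1 - snd_margin A f z \<partial>B) = 1 - s"
proof -
  note le = subcoupling_margins_le[OF assms(1)]
  have "s \<le> (\<integral>\<^sup>+y. 1 \<partial>A)" unfolding s_def by (rule nn_integral_mono_AE[OF le(1)])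
  then show s1: "s \<le> 1" by (simp add: A.emeasure_space_1)
  then have fin: "s \<noteq> \<infinity>" by (auto simp: top_unique)
  show "(\<integral>\<^sup>+y. 1 - fst_margin B f y \<partial>A) = 1 - s"
    unfolding s_def
    by (subst nn_integral_diff) (use fin le in \<open>auto simp: s_def A.emeasure_space_1\<close>)
  have s2: "s = (\<integral>\<^sup>+z. snd_margin A f z \<partial>B)" unfolding s_def by (rule margins_same_mass)
  show "(\<integral>\<^sup>+z. 1 - snd_margin A f z \<partial>B) = 1 - s"
    unfolding s2
    by (subst nn_integral_diff) (use fin le in \<open>auto simp: s2 B.emeasure_space_1\<close>)
qed

text \<open>Integrating out \<open>z\<close> replaces the factor \<open>1 - f\<^sub>2 z\<close> by the total missing mass \<open>1 - s\<close>, which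
  cancels against the normalisation and leaves \<open>f\<^sub>1 y + (1 - f\<^sub>1 y)\<close>.\<close>
lemma completed_density_fst_margin:
  "AE y in A. (\<integral>\<^sup>+z. completed_density A B f (y, z) \<partial>B) = 1"
proof (cases "subcoupling A B f")
  case False
  then show ?thesis by (simp add: completed_density_def B.emeasure_space_1)
next
  case True
  define s where "s = (\<integral>\<^sup>+y. fst_margin B f y \<partial>A)"
  note le = subcoupling_margins_le[OF True]
  note defects = subcoupling_defects[OF True, folded s_def]
  have zero: "AE y in A. 1 - s = 0 \<longrightarrow> 1 - fst_margin B f y = 0"
    using defects(2) by (cases "1 - s = 0") (simp_all add: nn_integral_0_iff_AE)
  show ?thesis
    using zero le(1) AE_space
  proof eventually_elim
    case (elim y)
    have [measurable]: "(\<lambda>z. f (y, z)) \<in> borel_measurable B" using elim by measurable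
    have "(\<integral>\<^sup>+z. completed_density A B f (y, z) \<partial>B)
        = (\<integral>\<^sup>+z. f (y, z) + (1 - fst_margin B f y) * (1 - snd_margin A f z) / (1 - s) \<partial>B)"
      using True by (simp add: completed_density_def s_def)
    also have "\<dots> = fst_margin B f y + (1 - fst_margin B f y) * (1 - s) / (1 - s)"
      by (simp add: nn_integral_add nn_integral_cmult nn_integral_divide defects(3) fst_margin_def)
    also have "\<dots> = 1"
    proof (cases "1 - s = 0")
      case True
      with elim show ?thesis by (simp add: diff_eq_0_iff_ennreal)
    next
      case False
      have "1 - s \<noteq> \<infinity>" by simp
      with False have "(1 - fst_margin B f y) * (1 - s) / (1 - s) = 1 - fst_margin B f y"
        by (simp add: ennreal_mult_divide_eq)
      with elim show ?thesis by (simp add: add.commute diff_add_cancel_ennreal)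
    qed
    finally show ?case .
  qed
qed

end

lemma completed_density_swap:
  assumes A: "prob_space A" and B: "prob_space B" and f: "f \<in> borel_measurable (A \<Otimes>\<^sub>M B)"
  shows "completed_density B A (\<lambda>w. f (snd w, fst w)) (z, y) = completed_density A B f (y, z)"
proof -
  have 1: "fst_margin A (\<lambda>w. f (snd w, fst w)) = snd_margin A f"
    by (auto simp: fst_margin_def snd_margin_def)
  have 2: "snd_margin B (\<lambda>w. f (snd w, fst w)) = fst_margin B f"
    by (auto simp: fst_margin_def snd_margin_def)
  show ?thesis
    using margins_same_mass[OF A B f]
    by (auto simp: completed_density_def subcoupling_def 1 2 mult.commute)
qed

lemma completed_density_snd_margin:
  assumes A: "prob_space A" and B: "prob_space B" and f [measurable]: "f \<in> borel_measurable (A \<Otimes>\<^sub>M B)"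
  shows "AE z in B. (\<integral>\<^sup>+y. completed_density A B f (y, z) \<partial>A) = 1"
proof -
  have "(\<lambda>w. f (snd w, fst w)) \<in> borel_measurable (B \<Otimes>\<^sub>M A)" by measurable
  from completed_density_fst_margin[OF B A this] show ?thesis
    by (simp add: completed_density_swap[OF A B f])
qed

lemma completed_coupling_in_couplings:
  fixes A B :: "'a::topological_space measure"
  assumes A: "is_prob A" and B: "is_prob B" and f [measurable]: "f \<in> borel_measurable (borel \<Otimes>\<^sub>M borel)"
  shows "completed_coupling A B f \<in> couplings A B"
proof -
  note [measurable_cong] = is_probD(2)[OF A] is_probD(2)[OF B]
  interpret A: prob_space A by (rule is_probD[OF A])
  interpret B: prob_space B by (rule is_probD[OF B])
  interpret AB: pair_prob_space A B ..
  have f' [measurable]: "f \<in> borel_measurable (A \<Otimes>\<^sub>M B)" by measurable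
  let ?d = "completed_density A B f"
  note pr = A.prob_space_axioms B.prob_space_axioms
  have d [measurable]: "?d \<in> borel_measurable (A \<Otimes>\<^sub>M B)"
    by (rule completed_density_measurable[OF pr f'])
  have sets: "sets (completed_coupling A B f) = sets (borel \<Otimes>\<^sub>M borel)"
    by (simp add: completed_coupling_def is_probD(2)[OF A] is_probD(2)[OF B] cong: sets_pair_measure_cong)
  note [measurable_cong] = sets
  have 1: "distr (completed_coupling A B f) borel fst = A"
  proof (rule measure_eqI)
    fix X assume "X \<in> sets (distr (completed_coupling A B f) borel fst)"
    then have X [measurable]: "X \<in> sets borel" by simp
    have "emeasure (distr (completed_coupling A B f) borel fst) X
        = (\<integral>\<^sup>+y. indicator X y \<partial>distr (completed_coupling A B f) borel fst)"
      by simp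
    also have "\<dots> = (\<integral>\<^sup>+w. indicator X (fst w) \<partial>completed_coupling A B f)"
      by (rule nn_integral_distr) auto
    also have "\<dots> = (\<integral>\<^sup>+w. ?d w * indicator X (fst w) \<partial>(A \<Otimes>\<^sub>M B))"
      unfolding completed_coupling_def by (subst nn_integral_density) auto
    also have "\<dots> = (\<integral>\<^sup>+y. (\<integral>\<^sup>+z. ?d (y, z) * indicator X y \<partial>B) \<partial>A)"
      by (subst B.nn_integral_fst[symmetric]) auto
    also have "\<dots> = (\<integral>\<^sup>+y. (\<integral>\<^sup>+z. ?d (y, z) \<partial>B) * indicator X y \<partial>A)"
      by (intro nn_integral_cong nn_integral_multc) measurable
    also have "\<dots> = (\<integral>\<^sup>+y. indicator X y \<partial>A)"
      using completed_density_fst_margin[OF pr f'] by (intro nn_integral_cong_AE) (auto elim!: eventually_mono)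
    finally show "emeasure (distr (completed_coupling A B f) borel fst) X = emeasure A X"
      by simp
  qed (simp add: is_probD(2)[OF A])
  have 2: "distr (completed_coupling A B f) borel snd = B"
  proof (rule measure_eqI)
    fix X assume "X \<in> sets (distr (completed_coupling A B f) borel snd)"
    then have X [measurable]: "X \<in> sets borel" by simp
    have "emeasure (distr (completed_coupling A B f) borel snd) X
        = (\<integral>\<^sup>+y. indicator X y \<partial>distr (completed_coupling A B f) borel snd)"
      by simp
    also have "\<dots> = (\<integral>\<^sup>+w. indicator X (snd w) \<partial>completed_coupling A B f)"
      by (rule nn_integral_distr) auto
    also have "\<dots> = (\<integral>\<^sup>+w. ?d w * indicator X (snd w) \<partial>(A \<Otimes>\<^sub>M B))"
      unfolding completed_coupling_def by (subst nn_integral_density) auto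
    also have "\<dots> = (\<integral>\<^sup>+z. (\<integral>\<^sup>+y. ?d (y, z) * indicator X z \<partial>A) \<partial>B)"
      by (subst AB.nn_integral_snd[symmetric]) auto
    also have "\<dots> = (\<integral>\<^sup>+z. (\<integral>\<^sup>+y. ?d (y, z) \<partial>A) * indicator X z \<partial>B)"
      by (intro nn_integral_cong nn_integral_multc) measurable
    also have "\<dots> = (\<integral>\<^sup>+z. indicator X z \<partial>B)"
      using completed_density_snd_margin[OF pr f'] by (intro nn_integral_cong_AE) (auto elim!: eventually_mono)
    finally show "emeasure (distr (completed_coupling A B f) borel snd) X = emeasure B X"
      by simp
  qed (simp add: is_probD(2)[OF B])
  have "prob_space (completed_coupling A B f)"
    by (rule prob_space_distrD[of fst _ borel]) (simp_all add: 1 A.prob_space_axioms)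
  with sets 1 2 show ?thesis by (simp add: couplings_def space_prob_algebra)
qed

text \<open>On the product part the cost is estimated crudely by \<open>2\<bar>y\<bar>\<^sup>2 + 2\<bar>z\<bar>\<^sup>2\<close>, and each summand
  depends on one variable only. Thus the completion costs at most twice the second moments of
  the missing mass.\<close>
lemma sq_cost_completed_coupling:
  fixes A B :: "'a::{real_normed_vector, second_countable_topology} measure"
  assumes A: "is_prob A" and B: "is_prob B" and f [measurable]: "f \<in> borel_measurable (borel \<Otimes>\<^sub>M borel)"
    and sub: "subcoupling A B f"
  shows "sq_cost (completed_coupling A B f)
      \<le> (\<integral>\<^sup>+(y, z). f (y, z) * ennreal ((norm (y - z))\<^sup>2) \<partial>(A \<Otimes>\<^sub>M B))
        + 2 * (\<integral>\<^sup>+y. (1 - fst_margin B f y) * ennreal ((norm y)\<^sup>2) \<partial>A)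
        + 2 * (\<integral>\<^sup>+z. (1 - snd_margin A f z) * ennreal ((norm z)\<^sup>2) \<partial>B)"
proof -
  note [measurable_cong] = is_probD(2)[OF A] is_probD(2)[OF B]
  interpret A: prob_space A by (rule is_probD[OF A])
  interpret B: prob_space B by (rule is_probD[OF B])
  interpret AB: pair_prob_space A B ..
  have f' [measurable]: "f \<in> borel_measurable (A \<Otimes>\<^sub>M B)" by measurable
  note pr = A.prob_space_axioms B.prob_space_axioms
  note [measurable] = completed_density_measurable[OF pr f'] fst_margin_measurable[OF pr f']
    snd_margin_measurable[OF pr f']
  define s where "s = (\<integral>\<^sup>+y. fst_margin B f y \<partial>A)"
  note defects = subcoupling_defects[OF pr f' sub, folded s_def]
  define F where "F y = 1 - fst_margin B f y" for y
  define G where "G z = 1 - snd_margin A f z" for z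
  have [measurable]: "F \<in> borel_measurable A" "G \<in> borel_measurable B"
    unfolding F_def G_def by measurable
  define q where "q = (1 - s) / (1 - s)"
  have q: "q \<le> 1" unfolding q_def 
    using le_less_trans[OF diff_le_self_ennreal ennreal_one_less_top, of s]
    by (cases "1 - s = 0") simp_all
  have FG: "(\<integral>\<^sup>+y. F y \<partial>A) = 1 - s" "(\<integral>\<^sup>+z. G z \<partial>B) = 1 - s"
    using defects by (simp_all add: F_def G_def)
  have "sq_cost (completed_coupling A B f)
      = (\<integral>\<^sup>+w. (f w + F (fst w) * G (snd w) / (1 - s)) * ennreal ((norm (fst w - snd w))\<^sup>2) \<partial>(A \<Otimes>\<^sub>M B))"
    unfolding completed_coupling_def
    by (subst nn_integral_density)
       (auto simp: completed_density_def sub F_def G_def s_def case_prod_unfold intro!: nn_integral_cong)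
  also have "\<dots> \<le> (\<integral>\<^sup>+w. f w * ennreal ((norm (fst w - snd w))\<^sup>2)
       + ((F (fst w) * G (snd w) / (1 - s)) * (2 * ennreal ((norm (fst w))\<^sup>2))
       + (F (fst w) * G (snd w) / (1 - s)) * (2 * ennreal ((norm (snd w))\<^sup>2))) \<partial>(A \<Otimes>\<^sub>M B))"
    unfolding distrib_right distrib_left[symmetric]
    by (intro nn_integral_mono add_left_mono mult_left_mono ennreal_norm_diff_squared_le) (auto intro: ennreal_norm_diff_squared_le)
  also have "\<dots> = (\<integral>\<^sup>+w. f w * ennreal ((norm (fst w - snd w))\<^sup>2) \<partial>(A \<Otimes>\<^sub>M B))
       + ((\<integral>\<^sup>+w. (F (fst w) * G (snd w) / (1 - s)) * (2 * ennreal ((norm (fst w))\<^sup>2)) \<partial>(A \<Otimes>\<^sub>M B))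
       + (\<integral>\<^sup>+w. (F (fst w) * G (snd w) / (1 - s)) * (2 * ennreal ((norm (snd w))\<^sup>2)) \<partial>(A \<Otimes>\<^sub>M B)))"
    by (simp add: nn_integral_add)
  also have "(\<integral>\<^sup>+w. (F (fst w) * G (snd w) / (1 - s)) * (2 * ennreal ((norm (fst w))\<^sup>2)) \<partial>(A \<Otimes>\<^sub>M B))
      = (\<integral>\<^sup>+y. (\<integral>\<^sup>+z. (F y * (2 * ennreal ((norm y)\<^sup>2)) * inverse (1 - s)) * G z \<partial>B) \<partial>A)"
    by (subst B.nn_integral_fst[symmetric]) (auto simp: divide_ennreal_def mult_ac)
  also have "\<dots> = (\<integral>\<^sup>+y. (2 * q) * (F y * ennreal ((norm y)\<^sup>2)) \<partial>A)"
    by (intro nn_integral_cong, subst nn_integral_cmult)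
       (auto simp: FG q_def divide_ennreal_def mult_ac)
  also have "\<dots> = (2 * q) * (\<integral>\<^sup>+y. F y * ennreal ((norm y)\<^sup>2) \<partial>A)"
    by (rule nn_integral_cmult) measurable
  also have "\<dots> \<le> (2 * 1) * (\<integral>\<^sup>+y. F y * ennreal ((norm y)\<^sup>2) \<partial>A)"
    by (intro mult_mono q) auto
  also have "(\<integral>\<^sup>+w. (F (fst w) * G (snd w) / (1 - s)) * (2 * ennreal ((norm (snd w))\<^sup>2)) \<partial>(A \<Otimes>\<^sub>M B))
      = (\<integral>\<^sup>+z. (\<integral>\<^sup>+y. (G z * (2 * ennreal ((norm z)\<^sup>2)) * inverse (1 - s)) * F y \<partial>A) \<partial>B)"
    by (subst AB.nn_integral_snd[symmetric]) (auto simp: divide_ennreal_def mult_ac)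
  also have "\<dots> = (\<integral>\<^sup>+z. (2 * q) * (G z * ennreal ((norm z)\<^sup>2)) \<partial>B)"
    by (intro nn_integral_cong, subst nn_integral_cmult)
       (auto simp: FG q_def divide_ennreal_def mult_ac)
  also have "\<dots> = (2 * q) * (\<integral>\<^sup>+z. G z * ennreal ((norm z)\<^sup>2) \<partial>B)"
    by (rule nn_integral_cmult) measurable
  also have "\<dots> \<le> (2 * 1) * (\<integral>\<^sup>+z. G z * ennreal ((norm z)\<^sup>2) \<partial>B)"
    by (intro mult_mono q) auto
  finally show ?thesis
    by (simp add: F_def G_def case_prod_unfold add.assoc)
qed

section \<open>Near-optimal couplings from a countable family\<close>

text \<open>The points of a countable dense set; they serve as the centres of the cells below.\<close>
definition dense_point :: "nat \<Rightarrow> 'a::{metric_space, second_countable_topology}" where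
  "dense_point = from_nat_into (SOME D. countable D \<and> (\<forall>X. open X \<longrightarrow> X \<noteq> {} \<longrightarrow> (\<exists>d\<in>D. d \<in> X)))"

lemma dense_point_close:
  fixes y :: "'a::{metric_space, second_countable_topology}"
  assumes "e > 0"
  shows "\<exists>i. dist y (dense_point i) < e"
proof -
  define D :: "'a set" where
    "D = (SOME D. countable D \<and> (\<forall>X. open X \<longrightarrow> X \<noteq> {} \<longrightarrow> (\<exists>d\<in>D. d \<in> X)))"
  have "countable D \<and> (\<forall>X. open X \<longrightarrow> X \<noteq> {} \<longrightarrow> (\<exists>d\<in>D. d \<in> X))"
    unfolding D_def by (rule someI_ex[OF countable_dense_exists])
  then have D: "countable D" "\<And>X. open X \<Longrightarrow> X \<noteq> {} \<Longrightarrow> \<exists>d\<in>D. d \<in> X"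
    by auto
  from D(2)[of "ball y e"] obtain d where d: "d \<in> D" "d \<in> ball y e"
    using assms by auto
  then obtain i where "from_nat_into D i = d"
    using from_nat_into_surj[OF D(1)] by blast
  with d show ?thesis unfolding dense_point_def D_def[symmetric] by auto
qed

text \<open>The index of the first centre within distance \<open>1 / Suc m\<close>. The fibres form a countable
  measurable partition into cells of diameter at most \<open>2 / Suc m\<close>.\<close>
definition cell :: "nat \<Rightarrow> 'a::{metric_space, second_countable_topology} \<Rightarrow> nat" where
  "cell m y = (LEAST i. dist y (dense_point i) < 1 / Suc m)"

lemma dist_cell: "dist y (dense_point (cell m y)) < 1 / Suc m"
  unfolding cell_def by (rule LeastI_ex) (simp add: dense_point_close)

lemma cell_measurable [measurable]: "cell m \<in> borel \<rightarrow>\<^sub>M count_space UNIV"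
  unfolding cell_def[abs_def] by measurable

text \<open>The countable family: \<open>m\<close> fixes the partition, and the list \<open>l\<close> gives the values on finitely many
  pairs of cells, enumerated by \<^const>\<open>prod_encode\<close>. The length of the list is also the common
  denominator of the values, so that longer lists allow both more cells and a finer rounding.\<close>
definition step_density ::
    "nat \<Rightarrow> nat list \<Rightarrow> 'a::{metric_space, second_countable_topology} \<times> 'a \<Rightarrow> ennreal" where
  "step_density m l w = (let t = prod_encode (cell m (fst w), cell m (snd w)) in
     if t < length l then ennreal (real (l ! t) / real (length l)) else 0)"

lemma step_density_measurable [measurable]:
  "step_density m l \<in> borel_measurable (borel \<Otimes>\<^sub>M borel)"
  unfolding step_density_def[abs_def] Let_def by measurable

lemma nn_integral_discrete_valued:
  fixes t :: "'a \<Rightarrow> nat"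
  assumes t [measurable]: "t \<in> M \<rightarrow>\<^sub>M count_space UNIV"
  shows "(\<integral>\<^sup>+w. H (t w) \<partial>M) = (\<Sum>n. H n * emeasure M {w \<in> space M. t w = n})"
proof -
  have "(\<integral>\<^sup>+w. H (t w) \<partial>M) = (\<integral>\<^sup>+w. (\<Sum>n. H n * indicator {w \<in> space M. t w = n} w) \<partial>M)"
  proof (rule nn_integral_cong)
    fix w assume w: "w \<in> space M"
    have "(\<lambda>n. H n * indicator {w \<in> space M. t w = n} w) sums
        (\<Sum>n\<in>{t w}. H n * indicator {w \<in> space M. t w = n} w)"
      by (rule sums_finite) (auto simp: w)
    with w show "H (t w) = (\<Sum>n. H n * indicator {w \<in> space M. t w = n} w)"
      by (simp add: sums_iff)
  qed
  also have "\<dots> = (\<Sum>n. \<integral>\<^sup>+w. H n * indicator {w \<in> space M. t w = n} w \<partial>M)"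
    by (rule nn_integral_suminf) measurable
  also have "\<dots> = (\<Sum>n. H n * emeasure M {w \<in> space M. t w = n})"
    by (intro suminf_cong nn_integral_cmult_indicator) measurable
  finally show ?thesis .
qed

lemma AE_discrete_value_charged:
  fixes t :: "'a \<Rightarrow> nat"
  assumes t [measurable]: "t \<in> M \<rightarrow>\<^sub>M count_space UNIV"
  shows "AE w in M. emeasure M {w' \<in> space M. t w' = t w} \<noteq> 0"
proof -
  have "AE w in M. \<forall>n. emeasure M {w' \<in> space M. t w' = n} = 0 \<longrightarrow> t w \<noteq> n"
    unfolding AE_all_countable
  proof
    fix n
    show "AE w in M. emeasure M {w' \<in> space M. t w' = n} = 0 \<longrightarrow> t w \<noteq> n"
      by (cases "emeasure M {w' \<in> space M. t w' = n} = 0")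
         (auto intro!: AE_I[where N="{w' \<in> space M. t w' = n}"])
  qed
  then show ?thesis by eventually_elim auto
qed

lemma tendsto_floor_fraction:
  fixes x :: real
  shows "(\<lambda>k. real_of_int \<lfloor>real k * x\<rfloor> / real k) \<longlonglongrightarrow> x"
proof (rule tendsto_sandwich)
  show "\<forall>\<^sub>F k in sequentially. x - 1 / real k \<le> real_of_int \<lfloor>real k * x\<rfloor> / real k"
    using eventually_gt_at_top[of 0]
  proof eventually_elim
    case (elim k)
    have "real k * x - 1 \<le> real_of_int \<lfloor>real k * x\<rfloor>" by linarith
    then have "(real k * x - 1) / real k \<le> real_of_int \<lfloor>real k * x\<rfloor> / real k"
      by (rule divide_right_mono) simp
    with elim show ?case by (simp add: diff_divide_distrib)
  qed
  show "\<forall>\<^sub>F k in sequentially. real_of_int \<lfloor>real k * x\<rfloor> / real k \<le> x"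
    using eventually_gt_at_top[of 0]
    by eventually_elim (simp add: divide_le_eq mult.commute)
  have "(\<lambda>k. x - 1 / real k) \<longlonglongrightarrow> x - 0" by (intro tendsto_intros lim_1_over_n)
  then show "(\<lambda>k. x - 1 / real k) \<longlonglongrightarrow> x" by simp
qed simp

lemma cell_sets [measurable]:
  "{y :: 'a::{metric_space, second_countable_topology}. cell m y = i} \<in> sets borel"
proof -
  have "{y \<in> space borel. cell m y = i} \<in> sets (borel :: 'a measure)" by measurable
  then show ?thesis by simp
qed

lemma pair_cell_sets [measurable]:
  "{w :: 'a::{metric_space, second_countable_topology} \<times> 'a. cell m (fst w) = i \<and> cell m (snd w) = j} \<in> sets (borel \<Otimes>\<^sub>M borel)"
proof -
  have "{w \<in> space (borel \<Otimes>\<^sub>M borel). cell m (fst w) = i \<and> cell m (snd w) = j} \<in> sets (borel \<Otimes>\<^sub>M (borel :: 'a measure))"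
    by measurable
  then show ?thesis by (simp add: space_pair_measure)
qed

lemma fst_cell_sets [measurable]:
  "{w. cell m (fst w) = i} \<in> sets (borel \<Otimes>\<^sub>M (borel :: 'a::{metric_space, second_countable_topology} measure))"
  "{w. cell m (snd w) = i} \<in> sets ((borel :: 'a measure) \<Otimes>\<^sub>M borel)"
proof -
  have "{w \<in> space (borel \<Otimes>\<^sub>M borel). cell m (fst w) = i} \<in> sets (borel \<Otimes>\<^sub>M (borel :: 'a measure))"
       "{w \<in> space (borel \<Otimes>\<^sub>M borel). cell m (snd w) = i} \<in> sets ((borel :: 'a measure) \<Otimes>\<^sub>M borel)"
    by measurable
  then show "{w. cell m (fst w) = i} \<in> sets (borel \<Otimes>\<^sub>M (borel :: 'a measure))"
    "{w. cell m (snd w) = i} \<in> sets ((borel :: 'a measure) \<Otimes>\<^sub>M borel)" by (simp_all add: space_pair_measure)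
qed

context
  fixes A B :: "'a::{real_normed_vector, second_countable_topology} measure"
    and P :: "('a \<times> 'a) measure" and m :: nat
  assumes A: "is_prob A" and B: "is_prob B" and P: "P \<in> couplings A B"
begin

interpretation A: prob_space A by (rule is_probD[OF A])
interpretation B: prob_space B by (rule is_probD[OF B])
interpretation AB: pair_prob_space A B ..
interpretation P: prob_space P by (rule couplingsD[OF P])

text \<open>Smoothing \<open>P\<close> over the cells: \<open>cell_ratio\<close> is the density, with respect to
  \<open>A \<otimes> B\<close>, of the measure that gives every pair of cells the mass it has under \<open>P\<close> and
  distributes it there proportionally to \<open>A \<otimes> B\<close>. A pair of cells that is null for the product
  is null for \<open>P\<close>, so the value \<open>0 / 0 = 0\<close> is the right one.\<close>
definition cell_mass where
  "cell_mass i j = emeasure P {w. cell m (fst w) = i \<and> cell m (snd w) = j}"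

definition cell_ratio where
  "cell_ratio i j = cell_mass i j / (emeasure A {y. cell m y = i} * emeasure B {z. cell m z = j})"

lemma space_P: "space P = UNIV"
  using sets_eq_imp_space_eq[OF couplingsD(2)[OF P]] by (simp add: space_pair_measure)

lemma emeasure_fst_cell: "emeasure P {w. cell m (fst w) = i} = emeasure A {y. cell m y = i}"
proof -
  note [measurable_cong] = is_probD(2)[OF A] is_probD(2)[OF B] couplingsD(2)[OF P]
  have "emeasure (distr P borel fst) {y. cell m y = i} = emeasure P {w. cell m (fst w) = i}"
    by (subst emeasure_distr) (auto simp: space_P vimage_def)
  then show ?thesis by (simp add: couplingsD(3)[OF P])
qed

lemma emeasure_snd_cell: "emeasure P {w. cell m (snd w) = j} = emeasure B {z. cell m z = j}"
proof -
  note [measurable_cong] = is_probD(2)[OF A] is_probD(2)[OF B] couplingsD(2)[OF P]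
  have "emeasure (distr P borel snd) {z. cell m z = j} = emeasure P {w. cell m (snd w) = j}"
    by (subst emeasure_distr) (auto simp: space_P vimage_def)
  then show ?thesis by (simp add: couplingsD(4)[OF P])
qed

lemma cell_mass_le:
  "cell_mass i j \<le> emeasure A {y. cell m y = i}" "cell_mass i j \<le> emeasure B {z. cell m z = j}"
  unfolding cell_mass_def emeasure_fst_cell[symmetric] emeasure_snd_cell[symmetric]
  by (rule emeasure_mono; auto simp: couplingsD(2)[OF P])+

lemma cell_ratio_times: "cell_ratio i j * (emeasure A {y. cell m y = i} * emeasure B {z. cell m z = j}) = cell_mass i j"
proof (cases "emeasure A {y. cell m y = i} * emeasure B {z. cell m z = j} = 0")
  case True
  then show ?thesis using cell_mass_le[of i j] by auto
next
  case False
  moreover have "emeasure A {y. cell m y = i} * emeasure B {z. cell m z = j} < \<top>"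
    by (simp add: ennreal_mult_less_top A.emeasure_eq_measure B.emeasure_eq_measure)
  ultimately show ?thesis
    unfolding cell_ratio_def by (simp add: ennreal_divide_times ennreal_mult_divide_eq ennreal_times_divide mult.commute)
qed

lemma cell_ratio_finite: "cell_ratio i j < \<top>"
proof (cases "emeasure A {y. cell m y = i} * emeasure B {z. cell m z = j} = 0")
  case True
  then have "cell_mass i j = 0" using cell_mass_le[of i j] by auto
  then show ?thesis by (simp add: cell_ratio_def)
next
  case False
  show ?thesis
    unfolding cell_ratio_def cell_mass_def
    using False by (auto simp: less_top[symmetric] ennreal_divide_eq_top_iff P.emeasure_eq_measure)
qed

lemma emeasure_cell_times:
  "emeasure (A \<Otimes>\<^sub>M B) {w. cell m (fst w) = i \<and> cell m (snd w) = j}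
    = emeasure A {y. cell m y = i} * emeasure B {z. cell m z = j}"
proof -
  note [measurable_cong] = is_probD(2)[OF A] is_probD(2)[OF B] couplingsD(2)[OF P]
  have "{w. cell m (fst w) = i \<and> cell m (snd w) = j} = {y::'a. cell m y = i} \<times> {z::'a. cell m z = j}"
    by auto
  then show ?thesis by (simp add: B.emeasure_pair_measure_Times)
qed

text \<open>On each pair of cells the denominator of the density cancels the product mass and leaves the mass
  under \<open>P\<close>. Costs that depend on the cells only can therefore be moved from the smoothed measure to
  \<open>P\<close>.\<close>
lemma nn_integral_cell_ratio:
  "(\<integral>\<^sup>+w. cell_ratio (cell m (fst w)) (cell m (snd w)) * h (cell m (fst w)) (cell m (snd w)) \<partial>(A \<Otimes>\<^sub>M B))
    = (\<integral>\<^sup>+w. h (cell m (fst w)) (cell m (snd w)) \<partial>P)"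
proof -
  note [measurable_cong] = is_probD(2)[OF A] is_probD(2)[OF B] couplingsD(2)[OF P]
  let ?t = "\<lambda>w::'a \<times> 'a. prod_encode (cell m (fst w), cell m (snd w))"
  have eq: "{w. ?t w = n} = {w. cell m (fst w) = fst (prod_decode n) \<and> cell m (snd w) = snd (prod_decode n)}" for n
  proof -
    have "prod_encode p = n \<longleftrightarrow> p = prod_decode n" for p
      by (metis prod_encode_inverse prod_decode_inverse)
    then show ?thesis by (simp add: prod_eq_iff)
  qed
  have sp: "space (A \<Otimes>\<^sub>M B) = UNIV" by (simp add: space_pair_measure is_probD(3)[OF A] is_probD(3)[OF B])
  let ?r = "case_prod cell_ratio" and ?h = "case_prod h"
  have "(\<integral>\<^sup>+w. ?r (prod_decode (?t w)) * ?h (prod_decode (?t w)) \<partial>(A \<Otimes>\<^sub>M B))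
      = (\<Sum>n. (?r (prod_decode n) * ?h (prod_decode n)) * emeasure (A \<Otimes>\<^sub>M B) {w \<in> space (A \<Otimes>\<^sub>M B). ?t w = n})"
    by (rule nn_integral_discrete_valued) measurable
  also have "\<dots> = (\<Sum>n. ?h (prod_decode n) * emeasure P {w \<in> space P. ?t w = n})"
  proof (rule suminf_cong)
    fix n
    obtain i j where n: "prod_decode n = (i, j)" by (cases "prod_decode n")
    have "cell_ratio i j * h i j * (emeasure A {y. cell m y = i} * emeasure B {z. cell m z = j}) = h i j * cell_mass i j"
      unfolding cell_ratio_times[symmetric] by (simp only: mult_ac)
    then show "(?r (prod_decode n) * ?h (prod_decode n)) * emeasure (A \<Otimes>\<^sub>M B) {w \<in> space (A \<Otimes>\<^sub>M B). ?t w = n}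
        = ?h (prod_decode n) * emeasure P {w \<in> space P. ?t w = n}"
      by (simp add: sp space_P eq n emeasure_cell_times cell_mass_def[symmetric])
  qed
  also have "\<dots> = (\<integral>\<^sup>+w. ?h (prod_decode (?t w)) \<partial>P)"
    by (rule nn_integral_discrete_valued[symmetric]) measurable
  finally show ?thesis by simp
qed

lemma cell_mass_sums:
  "(\<Sum>j. cell_mass i j) = emeasure A {y. cell m y = i}"
  "(\<Sum>i. cell_mass i j) = emeasure B {z. cell m z = j}"
proof -
  note [measurable_cong] = is_probD(2)[OF A] is_probD(2)[OF B] couplingsD(2)[OF P]
  have "(\<Sum>j. cell_mass i j) = emeasure P (\<Union>j. {w. cell m (fst w) = i \<and> cell m (snd w) = j})"
    unfolding cell_mass_def
    by (rule suminf_emeasure) (auto simp: disjoint_family_on_def couplingsD(2)[OF P])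
  also have "(\<Union>j. {w. cell m (fst w) = i \<and> cell m (snd w) = j}) = {w. cell m (fst w) = i}" by auto
  finally show "(\<Sum>j. cell_mass i j) = emeasure A {y. cell m y = i}" by (simp add: emeasure_fst_cell)
  have "(\<Sum>i. cell_mass i j) = emeasure P (\<Union>i. {w. cell m (fst w) = i \<and> cell m (snd w) = j})"
    unfolding cell_mass_def
    by (rule suminf_emeasure) (auto simp: disjoint_family_on_def couplingsD(2)[OF P])
  also have "(\<Union>i. {w. cell m (fst w) = i \<and> cell m (snd w) = j}) = {w. cell m (snd w) = j}" by auto
  finally show "(\<Sum>i. cell_mass i j) = emeasure B {z. cell m z = j}" by (simp add: emeasure_snd_cell)
qed

lemma cell_ratio_margins:
  "AE y in A. (\<integral>\<^sup>+z. cell_ratio (cell m y) (cell m z) \<partial>B) = 1"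
  "AE z in B. (\<integral>\<^sup>+y. cell_ratio (cell m y) (cell m z) \<partial>A) = 1"
proof -
  note [measurable_cong] = is_probD(2)[OF A] is_probD(2)[OF B] couplingsD(2)[OF P]
  let ?a = "\<lambda>i. emeasure A {y. cell m y = i}" and ?b = "\<lambda>j. emeasure B {z. cell m z = j}"
  have fin: "?a i < \<top>" "?b j < \<top>" for i j
    by (simp_all add: A.emeasure_eq_measure B.emeasure_eq_measure)
  have cancel1: "x = 1" if "x * a = 1 * a" "a \<noteq> 0" "a < \<top>" for x a :: ennreal
    using that ennreal_mult_divide_eq[of a x] by simp
  have cancel: "(cell_ratio i j * ?b j) * ?a i = cell_mass i j" "(cell_ratio i j * ?a i) * ?b j = cell_mass i j" for i j
    using cell_ratio_times[of i j] by (simp_all add: mult_ac)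
  have "AE y in A. ?a (cell m y) \<noteq> 0"
    using AE_discrete_value_charged[of "cell m" A] by (simp add: is_probD(3)[OF A])
  then show "AE y in A. (\<integral>\<^sup>+z. cell_ratio (cell m y) (cell m z) \<partial>B) = 1"
  proof eventually_elim
    case (elim y)
    let ?i = "cell m y"
    have "(\<integral>\<^sup>+z. cell_ratio ?i (cell m z) \<partial>B) = (\<Sum>j. cell_ratio ?i j * ?b j)"
      by (subst nn_integral_discrete_valued) (simp_all add: is_probD(3)[OF B])
    also have "\<dots> * ?a ?i = (\<Sum>j. cell_ratio ?i j * ?b j * ?a ?i)" by simp
    also have "\<dots> = 1 * ?a ?i" by (simp only: cancel cell_mass_sums) simp
    finally show ?case using elim fin(1)[of ?i] by (intro cancel1[of _ "?a ?i"]) simp_all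
  qed
  have "AE z in B. ?b (cell m z) \<noteq> 0"
    using AE_discrete_value_charged[of "cell m" B] by (simp add: is_probD(3)[OF B])
  then show "AE z in B. (\<integral>\<^sup>+y. cell_ratio (cell m y) (cell m z) \<partial>A) = 1"
  proof eventually_elim
    case (elim z)
    let ?j = "cell m z"
    have "(\<integral>\<^sup>+y. cell_ratio (cell m y) ?j \<partial>A) = (\<Sum>i. cell_ratio i ?j * ?a i)"
      by (subst nn_integral_discrete_valued[where H="\<lambda>i. cell_ratio i ?j"]) (simp_all add: is_probD(3)[OF A])
    also have "\<dots> * ?b ?j = (\<Sum>i. cell_ratio i ?j * ?a i * ?b ?j)" by simp
    also have "\<dots> = 1 * ?b ?j" by (simp only: cancel cell_mass_sums) simp
    finally show ?case using elim fin(2)[of ?j] by (intro cancel1[of _ "?b ?j"]) simp_all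
  qed
qed

definition cell_density :: "'a \<times> 'a \<Rightarrow> ennreal" where
  "cell_density w = cell_ratio (cell m (fst w)) (cell m (snd w))"

text \<open>Replacing \<open>y\<close> and \<open>z\<close> by the centres of their cells changes the distance by at most \<open>2d\<close>. This
  is done twice: from the smoothed measure to a function of the cells, and from there back to
  \<open>P\<close>. The resulting square \<open>(n + 4d)\<^sup>2\<close> is split by \<open>2n \<le> n\<^sup>2 + 1\<close>, so that the cost
  enters linearly.\<close>
lemma cell_density_cost_le:
  defines "d \<equiv> 1 / real (Suc m)"
  shows "(\<integral>\<^sup>+w. cell_density w * ennreal ((norm (fst w - snd w))\<^sup>2) \<partial>(A \<Otimes>\<^sub>M B))
    \<le> ennreal (1 + 4 * d) * sq_cost P + ennreal (4 * d + 16 * d\<^sup>2)"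
proof -
  note [measurable_cong] = couplingsD(2)[OF P]
  have d: "d > 0" by (simp add: d_def)
  let ?p = "dense_point :: nat \<Rightarrow> 'a"
  define h where "h i j = ennreal ((norm (?p i - ?p j) + 2 * d)\<^sup>2)" for i j
  have dc: "norm (y - ?p (cell m y)) < d" for y :: 'a
    using dist_cell[of y m] by (simp add: d_def dist_norm)
  have up: "norm (y - z) \<le> norm (?p (cell m y) - ?p (cell m z)) + 2 * d" for y z :: 'a
  proof -
    have "norm (y - z) = norm ((y - ?p (cell m y)) + (?p (cell m y) - ?p (cell m z)) - (z - ?p (cell m z)))"
      by simp
    also have "\<dots> \<le> norm (y - ?p (cell m y)) + norm (?p (cell m y) - ?p (cell m z)) + norm (z - ?p (cell m z))"
      by (intro order_trans[OF norm_triangle_ineq4] add_right_mono norm_triangle_ineq)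
    finally show ?thesis using dc[of y] dc[of z] by linarith
  qed
  have low: "norm (?p (cell m y) - ?p (cell m z)) \<le> norm (y - z) + 2 * d" for y z :: 'a
  proof -
    have "norm (?p (cell m y) - ?p (cell m z)) = norm ((z - ?p (cell m z)) + (y - z) - (y - ?p (cell m y)))"
      by simp
    also have "\<dots> \<le> norm (z - ?p (cell m z)) + norm (y - z) + norm (y - ?p (cell m y))"
      by (intro order_trans[OF norm_triangle_ineq4] add_right_mono norm_triangle_ineq)
    finally show ?thesis using dc[of y] dc[of z] by linarith
  qed
  have "(\<integral>\<^sup>+w. cell_density w * ennreal ((norm (fst w - snd w))\<^sup>2) \<partial>(A \<Otimes>\<^sub>M B))
      \<le> (\<integral>\<^sup>+w. cell_density w * h (cell m (fst w)) (cell m (snd w)) \<partial>(A \<Otimes>\<^sub>M B))"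
    unfolding h_def by (intro nn_integral_mono mult_left_mono ennreal_leI power_mono up) auto
  also have "\<dots> = (\<integral>\<^sup>+w. h (cell m (fst w)) (cell m (snd w)) \<partial>P)"
    unfolding cell_density_def by (rule nn_integral_cell_ratio)
  also have "\<dots> \<le> (\<integral>\<^sup>+w. ennreal (1 + 4 * d) * ennreal ((norm (fst w - snd w))\<^sup>2) + ennreal (4 * d + 16 * d\<^sup>2) \<partial>P)"
  proof (rule nn_integral_mono)
    fix w :: "'a \<times> 'a"
    let ?n = "norm (fst w - snd w)"
    have "(norm (?p (cell m (fst w)) - ?p (cell m (snd w))) + 2 * d)\<^sup>2 \<le> (?n + 4 * d)\<^sup>2"
      using low[of "fst w" "snd w"] d by (intro power_mono) auto
    also have "\<dots> = ?n\<^sup>2 + 4 * d * (2 * ?n * 1) + 16 * d\<^sup>2" by (simp add: power2_sum power_mult_distrib)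
    also have "\<dots> \<le> ?n\<^sup>2 + 4 * d * (?n\<^sup>2 + 1\<^sup>2) + 16 * d\<^sup>2"
      using d by (intro add_mono mult_left_mono sum_squares_bound) auto
    also have "\<dots> = (1 + 4 * d) * ?n\<^sup>2 + (4 * d + 16 * d\<^sup>2)" by (simp add: algebra_simps)
    finally have "h (cell m (fst w)) (cell m (snd w)) \<le> ennreal ((1 + 4 * d) * ?n\<^sup>2 + (4 * d + 16 * d\<^sup>2))"
      unfolding h_def by (rule ennreal_leI)
    also have "\<dots> = ennreal (1 + 4 * d) * ennreal (?n\<^sup>2) + ennreal (4 * d + 16 * d\<^sup>2)"
      using d by (subst ennreal_plus) (auto simp: ennreal_mult)
    finally show "h (cell m (fst w)) (cell m (snd w))
        \<le> ennreal (1 + 4 * d) * ennreal (?n\<^sup>2) + ennreal (4 * d + 16 * d\<^sup>2)" .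
  qed
  also have "\<dots> = ennreal (1 + 4 * d) * sq_cost P + ennreal (4 * d + 16 * d\<^sup>2)"
    by (simp add: nn_integral_add nn_integral_cmult case_prod_unfold P.emeasure_space_1)
  finally show ?thesis .
qed

text \<open>Rounding down, to multiples of \<open>1 / k\<close>, keeps the rounded function below the smoothed density,
  hence a sub-coupling, whereas rounding to nearest might not.\<close>
definition rounded_values :: "nat \<Rightarrow> nat list" where
  "rounded_values k = map (\<lambda>t. nat \<lfloor>real k * enn2real (case_prod (cell_ratio) (prod_decode t))\<rfloor>) [0..<k]"

lemma step_density_rounded_values:
  "step_density m (rounded_values k) w =
    (if prod_encode (cell m (fst w), cell m (snd w)) < k
     then ennreal (real_of_int \<lfloor>real k * enn2real (cell_density w)\<rfloor> / real k) else 0)"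
  unfolding step_density_def rounded_values_def cell_density_def Let_def by simp

lemma rounded_values_le: "step_density m (rounded_values k) w \<le> cell_density w"
proof (cases "prod_encode (cell m (fst w), cell m (snd w)) < k")
  case True
  then have "real_of_int \<lfloor>real k * enn2real (cell_density w)\<rfloor> / real k \<le> enn2real (cell_density w)"
    by (simp add: divide_le_eq mult.commute)
  then have "step_density m (rounded_values k) w \<le> ennreal (enn2real (cell_density w))"
    using True by (simp add: step_density_rounded_values ennreal_leI)
  then show ?thesis using cell_ratio_finite by (simp add: cell_density_def)
qed (simp add: step_density_rounded_values)

lemma rounded_values_tendsto: "(\<lambda>k. step_density m (rounded_values k) w) \<longlonglongrightarrow> cell_density w"
proof -
  have "(\<lambda>k. ennreal (real_of_int \<lfloor>real k * enn2real (cell_density w)\<rfloor> / real k)) \<longlonglongrightarrow> ennreal (enn2real (cell_density w))"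
    by (intro tendsto_ennrealI tendsto_floor_fraction)
  moreover have "ennreal (enn2real (cell_density w)) = cell_density w" using cell_ratio_finite by (simp add: cell_density_def)
  ultimately have "(\<lambda>k. ennreal (real_of_int \<lfloor>real k * enn2real (cell_density w)\<rfloor> / real k)) \<longlonglongrightarrow> cell_density w"
    by simp
  moreover have "\<forall>\<^sub>F k in sequentially. prod_encode (cell m (fst w), cell m (snd w)) < k"
    by (rule eventually_gt_at_top)
  then have "\<forall>\<^sub>F k in sequentially. ennreal (real_of_int \<lfloor>real k * enn2real (cell_density w)\<rfloor> / real k)
      = step_density m (rounded_values k) w"
    by eventually_elim (simp add: step_density_rounded_values)
  ultimately show ?thesis by (rule Lim_transform_eventually)
qed

lemma cell_density_measurable [measurable]: "cell_density \<in> borel_measurable (borel \<Otimes>\<^sub>M borel)"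
proof -
  have "(\<lambda>w. case_prod (cell_ratio) (cell m (fst w), cell m (snd w))) \<in> borel_measurable (borel \<Otimes>\<^sub>M borel)"
    by measurable
  then show ?thesis by (simp add: cell_density_def[abs_def])
qed

lemma cell_density_margins:
  "AE y in A. (\<integral>\<^sup>+z. cell_density (y, z) \<partial>B) = 1"
  "AE z in B. (\<integral>\<^sup>+y. cell_density (y, z) \<partial>A) = 1"
  using cell_ratio_margins by (simp_all add: cell_density_def)

lemma step_density_measurable_prod [measurable]:
  "step_density m l \<in> borel_measurable (A \<Otimes>\<^sub>M B)"
proof -
  have "sets (A \<Otimes>\<^sub>M B) = sets (borel \<Otimes>\<^sub>M borel)"
    by (intro sets_pair_measure_cong is_probD A B)
  from measurable_cong_sets[OF this refl] show ?thesis using step_density_measurable by blast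
qed

lemma rounded_values_margins_measurable [measurable]:
  "fst_margin B (step_density m l) \<in> borel_measurable A"
  "snd_margin A (step_density m l) \<in> borel_measurable B"
  by (intro fst_margin_measurable snd_margin_measurable A.prob_space_axioms B.prob_space_axioms
      step_density_measurable_prod)+

lemma rounded_values_subcoupling: "subcoupling A B (step_density m (rounded_values k))"
proof -
  have "AE y in A. fst_margin B (step_density m (rounded_values k)) y \<le> 1"
    using cell_density_margins(1)
  proof eventually_elim
    case (elim y)
    have "fst_margin B (step_density m (rounded_values k)) y \<le> (\<integral>\<^sup>+z. cell_density (y, z) \<partial>B)"
      unfolding fst_margin_def by (intro nn_integral_mono rounded_values_le)
    with elim show ?case by simp
  qed
  moreover have "AE z in B. snd_margin A (step_density m (rounded_values k)) z \<le> 1"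
    using cell_density_margins(2)
  proof eventually_elim
    case (elim z)
    have "snd_margin A (step_density m (rounded_values k)) z \<le> (\<integral>\<^sup>+y. cell_density (y, z) \<partial>A)"
      unfolding snd_margin_def by (intro nn_integral_mono rounded_values_le)
    with elim show ?case by simp
  qed
  ultimately show ?thesis unfolding subcoupling_def by (simp add: AE_le_one_iff)
qed

text \<open>The margins of the rounded functions tend to 1 by dominated convergence, the
  smoothed density being the majorant. So the missing mass tends to 0 pointwise, and the finite
  second moments provide the majorant for a second use of dominated convergence.\<close>
lemma rounded_values_defects_vanish:
  "second_moment A < \<infinity> \<Longrightarrow>
    (\<lambda>k. \<integral>\<^sup>+y. (1 - fst_margin B (step_density m (rounded_values k)) y) * ennreal ((norm y)\<^sup>2) \<partial>A) \<longlonglongrightarrow> 0"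
  "second_moment B < \<infinity> \<Longrightarrow>
    (\<lambda>k. \<integral>\<^sup>+z. (1 - snd_margin A (step_density m (rounded_values k)) z) * ennreal ((norm z)\<^sup>2) \<partial>B) \<longlonglongrightarrow> 0"
proof -
  note [measurable_cong] = is_probD(2)[OF A] is_probD(2)[OF B]
  have vanish: "(\<lambda>k. (1 - u k) * ennreal ((norm y)\<^sup>2)) \<longlonglongrightarrow> 0" if "u \<longlonglongrightarrow> 1" for u :: "nat \<Rightarrow> ennreal" and y :: 'a
  proof -
    have "(\<lambda>k. ennreal ((norm y)\<^sup>2) * (1 - u k)) \<longlonglongrightarrow> ennreal ((norm y)\<^sup>2) * (1 - 1)"
      by (intro ennreal_tendsto_cmult tendsto_diff_ennreal tendsto_const that) auto
    then show ?thesis by (simp add: mult.commute)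
  qed
  have bound: "(1 - u) * v \<le> v" for u v :: ennreal
    using mult_right_mono[OF diff_le_self_ennreal[of 1 u], of v] by simp
  {
    assume fin: "second_moment A < \<infinity>"
    have "AE y in A. (\<lambda>k. (1 - fst_margin B (step_density m (rounded_values k)) y) * ennreal ((norm y)\<^sup>2)) \<longlonglongrightarrow> 0"
      using cell_density_margins(1)
    proof eventually_elim
      case (elim y)
      have "(\<lambda>k. fst_margin B (step_density m (rounded_values k)) y) \<longlonglongrightarrow> (\<integral>\<^sup>+z. cell_density (y, z) \<partial>B)"
        unfolding fst_margin_def
        by (rule nn_integral_dominated_convergence[where w="\<lambda>z. cell_density (y, z)"])
           (use elim in \<open>auto simp: rounded_values_le rounded_values_tendsto\<close>)
      then show ?case using elim by (intro vanish) simp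
    qed
    then have "(\<lambda>k. \<integral>\<^sup>+y. (1 - fst_margin B (step_density m (rounded_values k)) y) * ennreal ((norm y)\<^sup>2) \<partial>A)
        \<longlonglongrightarrow> (\<integral>\<^sup>+y. 0 \<partial>A)"
      by (intro nn_integral_dominated_convergence[where w="\<lambda>y. ennreal ((norm y)\<^sup>2)"])
         (use fin in \<open>auto simp: bound\<close>)
    then show "(\<lambda>k. \<integral>\<^sup>+y. (1 - fst_margin B (step_density m (rounded_values k)) y) * ennreal ((norm y)\<^sup>2) \<partial>A) \<longlonglongrightarrow> 0"
      by simp
  next
    assume fin: "second_moment B < \<infinity>"
    have "AE z in B. (\<lambda>k. (1 - snd_margin A (step_density m (rounded_values k)) z) * ennreal ((norm z)\<^sup>2)) \<longlonglongrightarrow> 0"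
      using cell_density_margins(2)
    proof eventually_elim
      case (elim z)
      have "(\<lambda>k. snd_margin A (step_density m (rounded_values k)) z) \<longlonglongrightarrow> (\<integral>\<^sup>+y. cell_density (y, z) \<partial>A)"
        unfolding snd_margin_def
        by (rule nn_integral_dominated_convergence[where w="\<lambda>y. cell_density (y, z)"])
           (use elim in \<open>auto simp: rounded_values_le rounded_values_tendsto\<close>)
      then show ?case using elim by (intro vanish) simp
    qed
    then have "(\<lambda>k. \<integral>\<^sup>+z. (1 - snd_margin A (step_density m (rounded_values k)) z) * ennreal ((norm z)\<^sup>2) \<partial>B)
        \<longlonglongrightarrow> (\<integral>\<^sup>+z. 0 \<partial>B)"
      by (intro nn_integral_dominated_convergence[where w="\<lambda>z. ennreal ((norm z)\<^sup>2)"])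
         (use fin in \<open>auto simp: bound\<close>)
    then show "(\<lambda>k. \<integral>\<^sup>+z. (1 - snd_margin A (step_density m (rounded_values k)) z) * ennreal ((norm z)\<^sup>2) \<partial>B) \<longlonglongrightarrow> 0"
      by simp
  }
qed

end

text \<open>First choose the partition so fine that smoothing costs at most \<open>e / 2\<close>, then round so finely that
  the two completion terms, each weighted by 2, cost at most \<open>e / 4\<close> each.\<close>
lemma step_couplings_near_optimal:
  fixes A B :: "'a::{real_normed_vector, second_countable_topology} measure"
  assumes A: "is_prob A" and B: "is_prob B" and P: "P \<in> couplings A B"
    and fin: "second_moment A < \<infinity>" "second_moment B < \<infinity>" and c: "sq_cost P < \<infinity>" and e: "e > 0"
  shows "\<exists>m l. sq_cost (completed_coupling A B (step_density m l)) \<le> sq_cost P + ennreal e"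
proof -
  note [measurable_cong] = is_probD(2)[OF A] is_probD(2)[OF B]
  define C where "C = enn2real (sq_cost P)"
  have C: "sq_cost P = ennreal C" "C \<ge> 0" using c by (simp_all add: C_def)
  have "(\<lambda>m. 4 * (1 / real (Suc m)) * C + (4 * (1 / real (Suc m)) + 16 * (1 / real (Suc m))\<^sup>2))
      \<longlonglongrightarrow> 4 * 0 * C + (4 * 0 + 16 * 0\<^sup>2)"
    by (intro tendsto_intros LIMSEQ_Suc[OF lim_1_over_n])
  then have "\<forall>\<^sub>F m in sequentially. 4 * (1 / real (Suc m)) * C + (4 * (1 / real (Suc m)) + 16 * (1 / real (Suc m))\<^sup>2) < e / 2"
    by (rule order_tendstoD) (use e in simp)
  then obtain m where m: "4 * (1 / real (Suc m)) * C + (4 * (1 / real (Suc m)) + 16 * (1 / real (Suc m))\<^sup>2) < e / 2"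
    by (auto simp: eventually_sequentially)
  define d where "d = 1 / real (Suc m)"
  have d: "d > 0" by (simp add: d_def)
  let ?f = "\<lambda>k. step_density m (rounded_values A B P m k)"
  let ?E1 = "\<lambda>k. \<integral>\<^sup>+y. (1 - fst_margin B (?f k) y) * ennreal ((norm y)\<^sup>2) \<partial>A"
  let ?E2 = "\<lambda>k. \<integral>\<^sup>+z. (1 - snd_margin A (?f k) z) * ennreal ((norm z)\<^sup>2) \<partial>B"
  have "\<forall>\<^sub>F k in sequentially. ?E1 k < ennreal (e / 8)"
    by (rule order_tendstoD(2)[OF rounded_values_defects_vanish(1)[OF A B P fin(1)]]) (use e in simp)
  moreover have "\<forall>\<^sub>F k in sequentially. ?E2 k < ennreal (e / 8)"
    by (rule order_tendstoD(2)[OF rounded_values_defects_vanish(2)[OF A B P fin(2)]]) (use e in simp)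
  ultimately have "\<forall>\<^sub>F k in sequentially. ?E1 k < ennreal (e / 8) \<and> ?E2 k < ennreal (e / 8)"
    by (rule eventually_conj)
  then obtain k where k: "?E1 k < ennreal (e / 8)" "?E2 k < ennreal (e / 8)"
    by (auto simp: eventually_sequentially)
  have "(\<integral>\<^sup>+(y, z). ?f k (y, z) * ennreal ((norm (y - z))\<^sup>2) \<partial>(A \<Otimes>\<^sub>M B))
      \<le> (\<integral>\<^sup>+w. cell_density A B P m w * ennreal ((norm (fst w - snd w))\<^sup>2) \<partial>(A \<Otimes>\<^sub>M B))"
    unfolding case_prod_unfold
    by (intro nn_integral_mono mult_right_mono) (simp_all add: rounded_values_le[OF A B P])
  also have "\<dots> \<le> ennreal (1 + 4 * d) * sq_cost P + ennreal (4 * d + 16 * d\<^sup>2)"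
    unfolding d_def by (rule cell_density_cost_le[OF A B P])
  also have "\<dots> = ennreal ((1 + 4 * d) * C + (4 * d + 16 * d\<^sup>2))"
    using d C by (simp add: ennreal_mult)
  also have "\<dots> \<le> ennreal (C + e / 2)"
    using m unfolding d_def[symmetric] by (intro ennreal_leI) (simp add: algebra_simps)
  finally have 1: "(\<integral>\<^sup>+(y, z). ?f k (y, z) * ennreal ((norm (y - z))\<^sup>2) \<partial>(A \<Otimes>\<^sub>M B)) \<le> ennreal (C + e / 2)" .
  have "sq_cost (completed_coupling A B (?f k))
      \<le> (\<integral>\<^sup>+(y, z). ?f k (y, z) * ennreal ((norm (y - z))\<^sup>2) \<partial>(A \<Otimes>\<^sub>M B)) + 2 * ?E1 k + 2 * ?E2 k"
    by (intro sq_cost_completed_coupling A B rounded_values_subcoupling P) measurable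
  also have "\<dots> \<le> ennreal (C + e / 2) + 2 * ennreal (e / 8) + 2 * ennreal (e / 8)"
    using 1 k by (intro add_mono mult_left_mono) auto
  also have "\<dots> = ennreal (C + e)"
    using C(2) e by (simp flip: ennreal_plus ennreal_mult ennreal_numeral)
  also have "\<dots> = sq_cost P + ennreal e"
    using C e by simp
  finally show ?thesis by blast
qed

section \<open>Measurable selection and gluing of couplings\<close>

text \<open>For a fixed \<open>f\<close> the completion is given by explicit integrals against \<open>L x\<close> and \<open>K x\<close>. This
  is what makes couplings of this form preferable to optimal ones, whose dependence on \<open>x\<close> is not
  explicit.\<close>
lemma completed_coupling_kernel:
  fixes L K :: "'b \<Rightarrow> 'a::topological_space measure"
  assumes L: "L \<in> M \<rightarrow>\<^sub>M prob_algebra borel" and K: "K \<in> M \<rightarrow>\<^sub>M prob_algebra borel"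
    and f [measurable]: "f \<in> borel_measurable (borel \<Otimes>\<^sub>M borel)"
  shows "(\<lambda>x. completed_coupling (L x) (K x) f) \<in> M \<rightarrow>\<^sub>M prob_algebra (borel \<Otimes>\<^sub>M borel)"
proof -
  have Lx: "is_prob (L x)" and Kx: "is_prob (K x)" if "x \<in> space M" for x
    using measurable_space[OF L that] measurable_space[OF K that] by auto
  have cc: "prob_space (completed_coupling (L x) (K x) f)"
    "sets (completed_coupling (L x) (K x) f) = sets (borel \<Otimes>\<^sub>M borel)" if "x \<in> space M" for x
    using couplingsD[OF completed_coupling_in_couplings[OF Lx Kx f]] that by auto
  have [measurable]: "L \<in> M \<rightarrow>\<^sub>M subprob_algebra borel" "K \<in> M \<rightarrow>\<^sub>M subprob_algebra borel"
    using L K by (auto intro: measurable_prob_algebraD)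
  have marg1: "(\<lambda>p. fst_margin (K (fst p)) f (snd p)) \<in> borel_measurable (M \<Otimes>\<^sub>M borel)"
    unfolding fst_margin_def
    by (rule nn_integral_measurable_subprob_algebra2[where N=borel]) measurable
  have marg2: "(\<lambda>p. snd_margin (L (fst p)) f (snd p)) \<in> borel_measurable (M \<Otimes>\<^sub>M borel)"
    unfolding snd_margin_def
    by (rule nn_integral_measurable_subprob_algebra2[where N=borel]) measurable
  note [measurable] = marg1 marg2
  have mass [measurable]: "(\<lambda>x. \<integral>\<^sup>+y. fst_margin (K x) f y \<partial>L x) \<in> borel_measurable M"
    by (rule nn_integral_measurable_subprob_algebra2[where N=borel]) (simp_all add: case_prod_unfold)
  have "(\<lambda>x. \<integral>\<^sup>+y. fst_margin (K x) f y - 1 \<partial>L x) \<in> borel_measurable M"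
    by (rule nn_integral_measurable_subprob_algebra2[where N=borel]) (simp_all add: case_prod_unfold)
  moreover have "(\<lambda>x. \<integral>\<^sup>+z. snd_margin (L x) f z - 1 \<partial>K x) \<in> borel_measurable M"
    by (rule nn_integral_measurable_subprob_algebra2[where N=borel]) (simp_all add: case_prod_unfold)
  ultimately have sub [measurable]: "Measurable.pred M (\<lambda>x. subcoupling (L x) (K x) f)"
    unfolding subcoupling_def by measurable
  have [measurable]: "(\<lambda>p. fst_margin (K (fst p)) f (fst (snd p))) \<in> borel_measurable (M \<Otimes>\<^sub>M (borel \<Otimes>\<^sub>M borel))"
    using measurable_compose[OF _ marg1, of "\<lambda>p. (fst p, fst (snd p))" "M \<Otimes>\<^sub>M (borel \<Otimes>\<^sub>M borel)"]
    by simp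
  have [measurable]: "(\<lambda>p. snd_margin (L (fst p)) f (snd (snd p))) \<in> borel_measurable (M \<Otimes>\<^sub>M (borel \<Otimes>\<^sub>M borel))"
    using measurable_compose[OF _ marg2, of "\<lambda>p. (fst p, snd (snd p))" "M \<Otimes>\<^sub>M (borel \<Otimes>\<^sub>M borel)"]
    by simp
  have dens: "(\<lambda>(x, w). completed_density (L x) (K x) f w) \<in> borel_measurable (M \<Otimes>\<^sub>M (borel \<Otimes>\<^sub>M borel))"
    unfolding completed_density_def case_prod_unfold by measurable
  have pair: "(\<lambda>x. L x \<Otimes>\<^sub>M K x) \<in> M \<rightarrow>\<^sub>M subprob_algebra (borel \<Otimes>\<^sub>M borel)"
    using L K by (intro measurable_prob_algebraD measurable_pair_prob)
  show ?thesis
  proof (intro measurable_prob_algebraI cc measurable_subprob_algebra)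
    fix X :: "('a \<times> 'a) set" assume X [measurable]: "X \<in> sets (borel \<Otimes>\<^sub>M borel)"
    have "(\<lambda>x. \<integral>\<^sup>+w. completed_density (L x) (K x) f w * indicator X w \<partial>(L x \<Otimes>\<^sub>M K x)) \<in> borel_measurable M"
      by (rule nn_integral_measurable_subprob_algebra2[OF _ pair])
         (use dens in \<open>auto simp: case_prod_unfold\<close>)
    then show "(\<lambda>x. emeasure (completed_coupling (L x) (K x) f) X) \<in> borel_measurable M"
    proof (rule measurable_cong[THEN iffD1, rotated])
      fix x assume x: "x \<in> space M"
      have LK: "sets (L x \<Otimes>\<^sub>M K x) = sets (borel \<Otimes>\<^sub>M borel)"
        using x by (intro sets_pair_measure_cong is_probD(2) Lx Kx)
      have "completed_density (L x) (K x) f \<in> borel_measurable (L x \<Otimes>\<^sub>M K x)"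
        using x f by (intro completed_density_measurable is_probD(1) Lx Kx)
          (simp_all add: measurable_cong_sets[OF LK refl])
      then show "(\<integral>\<^sup>+w. completed_density (L x) (K x) f w * indicator X w \<partial>(L x \<Otimes>\<^sub>M K x))
          = emeasure (completed_coupling (L x) (K x) f) X"
        unfolding completed_coupling_def using X by (simp add: emeasure_density LK)
    qed
  qed (auto intro: prob_space_imp_subprob_space cc)
qed

lemma nn_integral_bind_kernel:
  assumes mu: "is_prob \<mu>" and P: "P \<in> borel \<rightarrow>\<^sub>M prob_algebra N" and f: "f \<in> borel_measurable N"
  shows "(\<integral>\<^sup>+w. f w \<partial>(\<mu> \<bind> P)) = (\<integral>\<^sup>+x. (\<integral>\<^sup>+w. f w \<partial>P x) \<partial>\<mu>)"
proof -
  have "P \<in> \<mu> \<rightarrow>\<^sub>M subprob_algebra N"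
    using measurable_prob_algebraD[OF P] by (simp add: measurable_cong_sets[OF is_probD(2)[OF mu] refl])
  from nn_integral_bind[OF f this] show ?thesis .
qed

lemma bind_in_couplings:
  fixes \<mu> :: "'b::topological_space measure" and L K :: "'b \<Rightarrow> 'a::topological_space measure"
  assumes mu: "is_prob \<mu>" and P: "P \<in> borel \<rightarrow>\<^sub>M prob_algebra (borel \<Otimes>\<^sub>M borel)"
    and c: "\<And>x. P x \<in> couplings (L x) (K x)"
  shows "\<mu> \<bind> P \<in> couplings (\<mu> \<bind> L) (\<mu> \<bind> K)"
proof -
  have P': "P \<in> \<mu> \<rightarrow>\<^sub>M subprob_algebra (borel \<Otimes>\<^sub>M borel)"
    using measurable_prob_algebraD[OF P] by (simp add: measurable_cong_sets[OF is_probD(2)[OF mu] refl])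
  have ne: "space \<mu> \<noteq> {}" by (simp add: is_probD(3)[OF mu])
  have "distr (\<mu> \<bind> P) borel fst = \<mu> \<bind> L"
    using c by (subst distr_bind[OF P' ne]) (auto simp: couplings_def)
  moreover have "distr (\<mu> \<bind> P) borel snd = \<mu> \<bind> K"
    using c by (subst distr_bind[OF P' ne]) (auto simp: couplings_def)
  moreover have "\<mu> \<bind> P \<in> space (prob_algebra (borel \<Otimes>\<^sub>M borel))"
    using measurable_space[OF measurable_bind_prob_space[OF measurable_const[OF mu] P], of undefined borel]
    by simp
  ultimately show ?thesis by (simp add: couplings_def)
qed

text \<open>With \<open>v x\<close> the infimum of the costs over the countable family, the first member whose cost is at
  most \<open>v x + e\<close> depends measurably on \<open>x\<close>. Since \<open>v\<close> agrees with the optimal cost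
  wherever \<open>L x\<close> has a finite second moment, mixing the chosen couplings proves the claim up to \<open>e\<close>.
  If the second moment of \<open>L x\<close> is infinite on a set of positive measure, so is the transport cost,
  since the second moments of \<open>K x\<close> are finite; then the right-hand side is infinite.\<close>
lemma D2_bind_le:
  fixes \<mu> :: "'b::topological_space measure" and L K :: "'b \<Rightarrow> 'a::{real_normed_vector, second_countable_topology} measure"
  assumes mu: "is_prob \<mu>"
    and L: "L \<in> borel \<rightarrow>\<^sub>M prob_algebra borel" and K: "K \<in> borel \<rightarrow>\<^sub>M prob_algebra borel"
    and fin: "\<And>x. second_moment (K x) < \<infinity>"
  shows "(D2 (\<mu> \<bind> L) (\<mu> \<bind> K))\<^sup>2 \<le> (\<integral>\<^sup>+x. (D2 (L x) (K x))\<^sup>2 \<partial>\<mu>)"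
proof -
  interpret mu: prob_space \<mu> by (rule is_probD[OF mu])
  note [measurable_cong] = is_probD(2)[OF mu]
  have Lx: "is_prob (L x)" and Kx: "is_prob (K x)" for x
    using measurable_space[OF L, of x] measurable_space[OF K, of x] by auto
  have Lsub [measurable]: "L \<in> borel \<rightarrow>\<^sub>M subprob_algebra borel" using L by (rule measurable_prob_algebraD)
  define p where "p n x = completed_coupling (L x) (K x)
      (case from_nat n of (m, l) \<Rightarrow> step_density m l)" for n x
  have p: "p n \<in> borel \<rightarrow>\<^sub>M prob_algebra (borel \<Otimes>\<^sub>M borel)" for n
    unfolding p_def by (cases "from_nat n :: nat \<times> nat list")
      (auto intro!: completed_coupling_kernel L K step_density_measurable)
  have p_coupling: "p n x \<in> couplings (L x) (K x)" for n x
    unfolding p_def by (cases "from_nat n :: nat \<times> nat list")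
      (auto intro!: completed_coupling_in_couplings Lx Kx step_density_measurable)
  have sq [measurable]: "(\<lambda>(x, y). ennreal ((norm (x - y))\<^sup>2)) \<in> borel_measurable (borel \<Otimes>\<^sub>M (borel :: 'a measure))"
    by measurable
  have cost [measurable]: "(\<lambda>x. sq_cost (p n x)) \<in> borel_measurable borel" for n
    by (rule measurable_compose[OF measurable_prob_algebraD[OF p] nn_integral_measurable_subprob_algebra[OF sq]])
  define v where "v x = (INF n. sq_cost (p n x))" for x
  have v [measurable]: "v \<in> borel_measurable borel" unfolding v_def by measurable
  have opt: "v x \<le> (D2 (L x) (K x))\<^sup>2" if "second_moment (L x) < \<infinity>" for x
    unfolding D2_squared
  proof (rule INF_greatest)
    fix P assume P: "P \<in> couplings (L x) (K x)"
    show "v x \<le> sq_cost P"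
    proof (cases "sq_cost P < \<infinity>")
      case True
      show ?thesis
      proof (rule ennreal_le_epsilon)
        fix e :: real assume "0 < e"
        from step_couplings_near_optimal[OF Lx Kx P that fin True this] obtain m l
          where ml: "sq_cost (completed_coupling (L x) (K x) (step_density m l)) \<le> sq_cost P + ennreal e"
          by blast
        have "v x \<le> sq_cost (p (to_nat (m, l)) x)" unfolding v_def by (rule INF_lower) simp
        with ml show "v x \<le> sq_cost P + ennreal e" by (simp add: p_def)
      qed
    qed (simp add: less_top[symmetric])
  qed
  show ?thesis
  proof (cases "AE x in \<mu>. second_moment (L x) < \<infinity>")
    case False
    have L2 [measurable]: "(\<lambda>x. second_moment (L x)) \<in> borel_measurable borel"
      by (rule measurable_compose[OF Lsub nn_integral_measurable_subprob_algebra]) measurable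
    \<comment> \<open>The transport cost is only bounded below by a measurable function here, which suffices
      because the integral is the supremum over measurable minorants.\<close>
    let ?E = "{x \<in> space \<mu>. second_moment (L x) = \<infinity>}"
    have E: "?E \<in> sets \<mu>" by measurable
    have "emeasure \<mu> ?E \<noteq> 0"
      using False AE_iff_measurable[OF E, of "\<lambda>x. second_moment (L x) < \<infinity>"]
      by (auto simp: less_top[symmetric])
    then have "\<infinity> = (\<integral>\<^sup>+x. \<infinity> * indicator ?E x \<partial>\<mu>)"
      using E by (subst nn_integral_cmult_indicator) (auto simp: ennreal_top_mult)
    also have "\<dots> \<le> (\<integral>\<^sup>+x. (D2 (L x) (K x))\<^sup>2 \<partial>\<mu>)"
    proof (rule nn_integral_mono)
      fix x
      show "\<infinity> * indicator ?E x \<le> (D2 (L x) (K x))\<^sup>2"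
        using second_moment_finite_if_D2_finite(1)[of "L x" "K x"] fin[of x]
        by (cases "x \<in> ?E") (auto simp: less_top[symmetric] top_unique)
    qed
    finally show ?thesis by (simp add: top_unique)
  next
    case True
    show ?thesis
    proof (rule ennreal_le_epsilon)
      fix e :: real assume e: "0 < e"
      define N where "N x = (LEAST n. sq_cost (p n x) \<le> v x + ennreal e)" for x
      have N [measurable]: "N \<in> borel \<rightarrow>\<^sub>M count_space UNIV"
        unfolding N_def[abs_def] by measurable
      have N_opt: "sq_cost (p (N x) x) \<le> v x + ennreal e" for x
        unfolding N_def
      proof (rule LeastI_ex)
        show "\<exists>n. sq_cost (p n x) \<le> v x + ennreal e"
        proof (cases "v x = \<infinity>")
          case False
          then have "v x < v x + ennreal e"
            using e by (cases "v x") (auto simp: ennreal_less_iff simp flip: ennreal_plus)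
          then obtain n where "sq_cost (p n x) < v x + ennreal e"
            unfolding v_def by (subst (asm) (1) INF_less_iff) auto
          then show ?thesis by (auto intro: less_imp_le)
        qed simp
      qed
      define P where "P x = p (N x) x" for x
      have P: "P \<in> borel \<rightarrow>\<^sub>M prob_algebra (borel \<Otimes>\<^sub>M borel)"
        unfolding P_def[abs_def] by (rule measurable_compose_countable[OF p N])
      have "\<mu> \<bind> P \<in> couplings (\<mu> \<bind> L) (\<mu> \<bind> K)"
        by (rule bind_in_couplings[OF mu P]) (simp add: P_def p_coupling)
      then have "(D2 (\<mu> \<bind> L) (\<mu> \<bind> K))\<^sup>2 \<le> sq_cost (\<mu> \<bind> P)"
        unfolding D2_squared by (rule INF_lower)
      also have "\<dots> = (\<integral>\<^sup>+x. sq_cost (P x) \<partial>\<mu>)"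
        by (rule nn_integral_bind_kernel[OF mu P sq])
      also have "\<dots> \<le> (\<integral>\<^sup>+x. v x + ennreal e \<partial>\<mu>)"
        unfolding P_def by (intro nn_integral_mono N_opt)
      also have "\<dots> = (\<integral>\<^sup>+x. v x \<partial>\<mu>) + ennreal e"
        by (subst nn_integral_add) (auto simp: mu.emeasure_space_1)
      also have "(\<integral>\<^sup>+x. v x \<partial>\<mu>) \<le> (\<integral>\<^sup>+x. (D2 (L x) (K x))\<^sup>2 \<partial>\<mu>)"
        using True by (intro nn_integral_mono_AE) (auto elim!: eventually_mono intro: opt)
      finally show "(D2 (\<mu> \<bind> L) (\<mu> \<bind> K))\<^sup>2 \<le> (\<integral>\<^sup>+x. (D2 (L x) (K x))\<^sup>2 \<partial>\<mu>) + ennreal e"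
        by (simp add: add_right_mono)
    qed
  qed
qed

section \<open>The chain rule for relative entropy\<close>

lemma sets_kernel_prod:
  fixes \<mu> :: "'a::topological_space measure"
  assumes mu: "is_prob \<mu>" and K: "markov_transition K"
  shows "sets (kernel_prod \<mu> K) = sets (borel \<Otimes>\<^sub>M borel)"
  unfolding kernel_prod_def using is_probD(3)[OF mu] by (subst sets_bind) auto

lemma kernel_prod_kernel:
  fixes K :: "'a::topological_space \<Rightarrow> 'a measure"
  assumes K: "markov_transition K"
  shows "(\<lambda>x. distr (K x) (borel \<Otimes>\<^sub>M borel) (Pair x)) \<in> borel \<rightarrow>\<^sub>M prob_algebra (borel \<Otimes>\<^sub>M borel)"
  by (rule measurable_distr_prob_space2[OF K]) simp

lemma nn_integral_kernel_prod:
  fixes \<mu> :: "'a::topological_space measure"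
  assumes mu: "is_prob \<mu>" and K: "markov_transition K" and f [measurable]: "f \<in> borel_measurable (borel \<Otimes>\<^sub>M borel)"
  shows "(\<integral>\<^sup>+w. f w \<partial>kernel_prod \<mu> K) = (\<integral>\<^sup>+x. (\<integral>\<^sup>+y. f (x, y) \<partial>K x) \<partial>\<mu>)"
proof -
  have "(\<lambda>x. distr (K x) (borel \<Otimes>\<^sub>M borel) (Pair x)) \<in> \<mu> \<rightarrow>\<^sub>M subprob_algebra (borel \<Otimes>\<^sub>M borel)"
    using measurable_prob_algebraD[OF kernel_prod_kernel[OF K]]
    by (simp add: measurable_cong_sets[OF is_probD(2)[OF mu] refl])
  from nn_integral_bind[OF f this]
  have "(\<integral>\<^sup>+w. f w \<partial>kernel_prod \<mu> K) = (\<integral>\<^sup>+x. (\<integral>\<^sup>+w. f w \<partial>distr (K x) (borel \<Otimes>\<^sub>M borel) (Pair x)) \<partial>\<mu>)"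
    unfolding kernel_prod_def .
  also have "\<dots> = (\<integral>\<^sup>+x. (\<integral>\<^sup>+y. f (x, y) \<partial>K x) \<partial>\<mu>)"
  proof (rule nn_integral_cong)
    fix x
    note [measurable_cong] = is_probD(2)[OF markov_transitionD[OF K, of x]]
    have "Pair x \<in> K x \<rightarrow>\<^sub>M borel \<Otimes>\<^sub>M borel" by measurable
    then show "(\<integral>\<^sup>+w. f w \<partial>distr (K x) (borel \<Otimes>\<^sub>M borel) (Pair x)) = (\<integral>\<^sup>+y. f (x, y) \<partial>K x)"
      by (rule nn_integral_distr) (use f in simp)
  qed
  finally show ?thesis .
qed

lemma prob_space_kernel_prod:
  fixes \<mu> :: "'a::topological_space measure"
  assumes mu: "is_prob \<mu>" and K: "markov_transition K"
  shows "prob_space (kernel_prod \<mu> K)"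
  unfolding kernel_prod_def by (rule prob_space_bind'[OF mu kernel_prod_kernel[OF K]])

text \<open>Finite intersections of the sets of a countable topological basis; the empty intersection
  supplies the whole space.\<close>
lemma borel_countable_generator:
  obtains G :: "'a::second_countable_topology set set"
  where "countable G" "Int_stable G" "UNIV \<in> G" "sets borel = sigma_sets UNIV G"
proof -
  obtain B :: "'a set set" where B: "countable B" "topological_basis B"
    using ex_countable_basis by blast
  define G where "G = Inter ` {F. finite F \<and> F \<subseteq> B}"
  have "countable G"
    unfolding G_def using B(1) by (intro countable_image countable_Collect_finite_subset)
  moreover have "Int_stable G"
    unfolding Int_stable_def G_def
  proof safe
    fix F H assume "finite F" "F \<subseteq> B" "finite H" "H \<subseteq> B"
    then show "\<Inter>F \<inter> \<Inter>H \<in> Inter ` {F. finite F \<and> F \<subseteq> B}"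
      by (intro image_eqI[of _ _ "F \<union> H"]) auto
  qed
  moreover have "UNIV \<in> G" unfolding G_def by (intro image_eqI[of _ _ "{}"]) auto
  moreover have "sets borel = sigma_sets UNIV G"
  proof (intro equalityI)
    have "B \<subseteq> G" unfolding G_def
    proof
      fix X assume "X \<in> B"
      then show "X \<in> Inter ` {F. finite F \<and> F \<subseteq> B}" by (intro image_eqI[of _ _ "{X}"]) auto
    qed
    moreover have "sets borel = sigma_sets UNIV B"
      by (subst borel_eq_countable_basis[OF B]) simp
    ultimately show "sets borel \<subseteq> sigma_sets UNIV G" by (simp add: sigma_sets_mono')
    have "G \<subseteq> sets borel"
      unfolding G_def using topological_basis_open[OF B(2)] by (auto intro!: borel_open open_Inter)
    then show "sigma_sets UNIV G \<subseteq> sets borel"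
      using sets.sigma_sets_subset[of G borel] by simp
  qed
  ultimately show thesis by (rule that)
qed

text \<open>For a fixed Borel set \<open>A\<close>, testing the hypothesis on rectangles \<open>C \<times> A\<close> shows that \<open>L x\<close> and the
  density measure agree on \<open>A\<close> for almost every \<open>x\<close>. The exceptional null set depends on \<open>A\<close>,
  so \<open>A\<close> is restricted to a countable generator before the uniqueness of measures is used.\<close>
lemma kernel_prod_density_AE:
  fixes \<mu> :: "'a::second_countable_topology measure"
  assumes mu: "is_prob \<mu>" and K: "markov_transition K" and L: "markov_transition L"
    and r [measurable]: "r \<in> borel_measurable (borel \<Otimes>\<^sub>M borel)"
    and eq: "kernel_prod \<mu> L = density (kernel_prod \<mu> K) r"
  shows "AE x in \<mu>. L x = density (K x) (\<lambda>y. r (x, y))"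
proof -
  interpret mu: prob_space \<mu> by (rule is_probD[OF mu])
  note [measurable_cong] = is_probD(2)[OF mu]
  note Kx [measurable_cong] = is_probD(2)[OF markov_transitionD[OF K]]
  note Lx [measurable_cong] = is_probD(2)[OF markov_transitionD[OF L]]
  have [measurable]: "L \<in> borel \<rightarrow>\<^sub>M subprob_algebra borel" "K \<in> borel \<rightarrow>\<^sub>M subprob_algebra borel"
    using L K by (auto intro: measurable_prob_algebraD)
  obtain G :: "'a set set" where G: "countable G" "Int_stable G" "UNIV \<in> G" "sets borel = sigma_sets UNIV G"
    by (rule borel_countable_generator)
  have G_sets: "A \<in> sets borel" if "A \<in> G" for A using that G(4) by auto
  have "AE x in \<mu>. emeasure (L x) A = (\<integral>\<^sup>+y. r (x, y) * indicator A y \<partial>K x)" if A [measurable]: "A \<in> sets borel" for A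
  proof (rule mu.density_unique_finite_measure)
    show "(\<lambda>x. emeasure (L x) A) \<in> borel_measurable \<mu>" by measurable
    have "(\<lambda>x. \<integral>\<^sup>+y. r (x, y) * indicator A y \<partial>K x) \<in> borel_measurable borel"
      by (rule nn_integral_measurable_subprob_algebra2[where N=borel]) measurable
    then show int [measurable]: "(\<lambda>x. \<integral>\<^sup>+y. r (x, y) * indicator A y \<partial>K x) \<in> borel_measurable \<mu>" by measurable
    fix C assume "C \<in> sets \<mu>"
    then have C [measurable]: "C \<in> sets borel" by (simp add: is_probD(2)[OF mu])
    have "(\<integral>\<^sup>+x. emeasure (L x) A * indicator C x \<partial>\<mu>)
        = (\<integral>\<^sup>+x. (\<integral>\<^sup>+y. indicator C x * indicator A y \<partial>L x) \<partial>\<mu>)"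
      by (intro nn_integral_cong, subst nn_integral_cmult) (auto simp: Lx mult.commute)
    also have "\<dots> = (\<integral>\<^sup>+w. indicator C (fst w) * indicator A (snd w) \<partial>kernel_prod \<mu> L)"
      by (subst nn_integral_kernel_prod[OF mu L]) auto
    also have "\<dots> = (\<integral>\<^sup>+w. r w * (indicator C (fst w) * indicator A (snd w)) \<partial>kernel_prod \<mu> K)"
      unfolding eq by (rule nn_integral_density) (simp_all add: measurable_cong_sets[OF sets_kernel_prod[OF mu K] refl])
    also have "\<dots> = (\<integral>\<^sup>+x. (\<integral>\<^sup>+y. indicator C x * (r (x, y) * indicator A y) \<partial>K x) \<partial>\<mu>)"
      by (subst nn_integral_kernel_prod[OF mu K]) (auto simp: mult_ac)
    also have "\<dots> = (\<integral>\<^sup>+x. (\<integral>\<^sup>+y. r (x, y) * indicator A y \<partial>K x) * indicator C x \<partial>\<mu>)"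
      by (intro nn_integral_cong) (simp add: nn_integral_cmult mult.commute)
    finally show "(\<integral>\<^sup>+x. emeasure (L x) A * indicator C x \<partial>\<mu>)
        = (\<integral>\<^sup>+x. (\<integral>\<^sup>+y. r (x, y) * indicator A y \<partial>K x) * indicator C x \<partial>\<mu>)" .
  qed auto
  then have "AE x in \<mu>. \<forall>A\<in>G. emeasure (L x) A = (\<integral>\<^sup>+y. r (x, y) * indicator A y \<partial>K x)"
    using G_sets by (simp add: AE_ball_countable[OF G(1)])
  then show ?thesis
  proof eventually_elim
    case (elim x)
    interpret Lx: prob_space "L x" by (rule is_probD(1)[OF markov_transitionD[OF L]])
    show ?case
    proof (rule measure_eqI_generator_eq[OF G(2), where \<Omega>=UNIV and A="\<lambda>_. UNIV"])
      fix A assume "A \<in> G"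
      then have "A \<in> sets borel" by (rule G_sets)
      with elim \<open>A \<in> G\<close> show "emeasure (L x) A = emeasure (density (K x) (\<lambda>y. r (x, y))) A"
        by (subst emeasure_density) (auto simp: Kx)
    qed (use G in \<open>auto simp: Kx Lx\<close>)
  qed
qed

text \<open>Any version of the density may be used in the definition of relative entropy. The last
  two bounds are what allows the difference to be integrated term by term.\<close>
lemma rel_entropy_density:
  assumes eta: "prob_space \<eta>" and nu: "prob_space \<nu>" and r [measurable]: "r \<in> borel_measurable \<eta>"
    and eq: "\<nu> = density \<eta> r"
  defines "l \<equiv> \<lambda>x. ln (enn2real (r x))"
  shows "rel_entropy \<nu> \<eta> = (\<integral>\<^sup>+x. ennreal (l x) \<partial>\<nu>) - (\<integral>\<^sup>+x. ennreal (- l x) \<partial>\<nu>)"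
    and "(\<integral>\<^sup>+x. ennreal (- l x) \<partial>\<nu>) \<le> 1"
    and "(\<integral>\<^sup>+x. ennreal (- l x) \<partial>\<nu>) \<le> (\<integral>\<^sup>+x. ennreal (l x) \<partial>\<nu>)"
proof -
  interpret eta: prob_space \<eta> by fact
  have sets: "sets \<nu> = sets \<eta>" by (simp add: eq)
  have ac: "absolutely_continuous \<eta> \<nu>" unfolding eq by (rule absolutely_continuousI_density[OF r])
  have "AE x in \<eta>. r x = RN_deriv \<eta> \<nu> x" by (rule eta.RN_deriv_unique[OF r]) (simp add: eq)
  then have "AE x in \<nu>. r x = RN_deriv \<eta> \<nu> x" by (rule absolutely_continuous_AE[OF sets ac])
  then have "AE x in \<nu>. l x = ln (enn2real (RN_deriv \<eta> \<nu> x))"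
    by eventually_elim (simp add: l_def)
  then have int: "(\<integral>\<^sup>+x. ennreal (l x) \<partial>\<nu>) = (\<integral>\<^sup>+x. ennreal (ln (enn2real (RN_deriv \<eta> \<nu> x))) \<partial>\<nu>)"
    "(\<integral>\<^sup>+x. ennreal (- l x) \<partial>\<nu>) = (\<integral>\<^sup>+x. ennreal (- ln (enn2real (RN_deriv \<eta> \<nu> x))) \<partial>\<nu>)"
    by (auto intro!: nn_integral_cong_AE elim!: eventually_mono)
  show "rel_entropy \<nu> \<eta> = (\<integral>\<^sup>+x. ennreal (l x) \<partial>\<nu>) - (\<integral>\<^sup>+x. ennreal (- l x) \<partial>\<nu>)"
    by (simp add: rel_entropy_def ac int)
  show "(\<integral>\<^sup>+x. ennreal (- l x) \<partial>\<nu>) \<le> 1" "(\<integral>\<^sup>+x. ennreal (- l x) \<partial>\<nu>) \<le> (\<integral>\<^sup>+x. ennreal (l x) \<partial>\<nu>)"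
    unfolding int by (rule rel_entropy_well_defined[OF nu eta sets ac])+
qed

text \<open>The fibrewise entropy agrees almost everywhere with a measurable function \<open>h\<close>,
  which is a difference of two integrals of the joint log-density. Supplying \<open>h\<close> avoids the question
  whether \<open>x \<mapsto> rel_entropy (L x) (K x)\<close> is itself measurable.\<close>
lemma rel_entropy_chain_rule:
  fixes \<mu> :: "'a::second_countable_topology measure"
  assumes mu: "is_prob \<mu>" and K: "markov_transition K" and L: "markov_transition L"
    and fin: "rel_entropy (kernel_prod \<mu> L) (kernel_prod \<mu> K) \<noteq> \<infinity>"
  obtains h where "h \<in> borel_measurable borel" "AE x in \<mu>. rel_entropy (L x) (K x) = h x"
    "(\<integral>\<^sup>+x. h x \<partial>\<mu>) = rel_entropy (kernel_prod \<mu> L) (kernel_prod \<mu> K)"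
proof -
  interpret mu: prob_space \<mu> by (rule is_probD[OF mu])
  interpret N: prob_space "kernel_prod \<mu> K" by (rule prob_space_kernel_prod[OF mu K])
  interpret M: prob_space "kernel_prod \<mu> L" by (rule prob_space_kernel_prod[OF mu L])
  note [measurable_cong] = is_probD(2)[OF mu]
  have [measurable]: "L \<in> borel \<rightarrow>\<^sub>M subprob_algebra borel"
    using L by (auto intro: measurable_prob_algebraD)
  define r where "r = RN_deriv (kernel_prod \<mu> K) (kernel_prod \<mu> L)"
  have ac: "absolutely_continuous (kernel_prod \<mu> K) (kernel_prod \<mu> L)"
    using fin by (auto simp: rel_entropy_def split: if_splits)
  have r0: "r \<in> borel_measurable (kernel_prod \<mu> K)" unfolding r_def by simp
  then have r [measurable]: "r \<in> borel_measurable (borel \<Otimes>\<^sub>M borel)"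
    by (simp add: measurable_cong_sets[OF sets_kernel_prod[OF mu K] refl])
  have eq: "kernel_prod \<mu> L = density (kernel_prod \<mu> K) r"
    unfolding r_def by (rule N.density_RN_deriv[symmetric, OF ac]) (simp add: sets_kernel_prod mu K L)
  define l where "l w = ln (enn2real (r w))" for w
  have l [measurable]: "l \<in> borel_measurable (borel \<Otimes>\<^sub>M borel)" unfolding l_def[abs_def] by measurable
  define p where "p x = (\<integral>\<^sup>+y. ennreal (l (x, y)) \<partial>L x)" for x
  define q where "q x = (\<integral>\<^sup>+y. ennreal (- l (x, y)) \<partial>L x)" for x
  have p [measurable]: "p \<in> borel_measurable borel" unfolding p_def
    by (rule nn_integral_measurable_subprob_algebra2[where N=borel]) measurable
  have q [measurable]: "q \<in> borel_measurable borel" unfolding q_def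
    by (rule nn_integral_measurable_subprob_algebra2[where N=borel]) measurable
  have fib: "AE x in \<mu>. rel_entropy (L x) (K x) = p x - q x \<and> q x \<le> 1 \<and> q x \<le> p x"
    using kernel_prod_density_AE[OF mu K L r eq]
  proof eventually_elim
    case (elim x)
    have pr: "prob_space (K x)" "prob_space (L x)"
      by (rule is_probD(1)[OF markov_transitionD[OF K]] is_probD(1)[OF markov_transitionD[OF L]])+
    have "(\<lambda>y. r (x, y)) \<in> borel_measurable (K x)"
      by (simp add: measurable_cong_sets[OF is_probD(2)[OF markov_transitionD[OF K]] refl])
    from rel_entropy_density[OF pr this elim] show ?case by (simp add: p_def q_def l_def)
  qed
  show thesis
  proof (rule that[of "\<lambda>x. p x - q x"])
    show "(\<lambda>x. p x - q x) \<in> borel_measurable borel" by measurable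
    show "AE x in \<mu>. rel_entropy (L x) (K x) = p x - q x" using fib by eventually_elim simp
    have "(\<integral>\<^sup>+x. q x \<partial>\<mu>) \<le> (\<integral>\<^sup>+x. 1 \<partial>\<mu>)"
      using fib by (intro nn_integral_mono_AE) (auto elim!: eventually_mono)
    then have "(\<integral>\<^sup>+x. q x \<partial>\<mu>) \<noteq> \<infinity>" by (auto simp: mu.emeasure_space_1 top_unique)
    then have "(\<integral>\<^sup>+x. p x - q x \<partial>\<mu>) = (\<integral>\<^sup>+x. p x \<partial>\<mu>) - (\<integral>\<^sup>+x. q x \<partial>\<mu>)"
      using fib by (intro nn_integral_diff) (auto elim!: eventually_mono)
    also have "(\<integral>\<^sup>+x. p x \<partial>\<mu>) = (\<integral>\<^sup>+w. ennreal (l w) \<partial>kernel_prod \<mu> L)"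
      unfolding p_def by (rule nn_integral_kernel_prod[OF mu L, symmetric]) measurable
    also have "(\<integral>\<^sup>+x. q x \<partial>\<mu>) = (\<integral>\<^sup>+w. ennreal (- l w) \<partial>kernel_prod \<mu> L)"
      unfolding q_def by (rule nn_integral_kernel_prod[OF mu L, symmetric]) measurable
    also have "(\<integral>\<^sup>+w. ennreal (l w) \<partial>kernel_prod \<mu> L) - (\<integral>\<^sup>+w. ennreal (- l w) \<partial>kernel_prod \<mu> L)
        = rel_entropy (kernel_prod \<mu> L) (kernel_prod \<mu> K)"
      unfolding l_def by (rule rel_entropy_density(1)[OF N.prob_space_axioms M.prob_space_axioms r0 eq, symmetric])
    finally show "(\<integral>\<^sup>+x. p x - q x \<partial>\<mu>) = rel_entropy (kernel_prod \<mu> L) (kernel_prod \<mu> K)" .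
  qed
qed

section \<open>Means and covariances along a coupling\<close>

lemma ennreal_power2_le_imp_le:
  fixes x y :: ennreal
  assumes "x\<^sup>2 \<le> y\<^sup>2"
  shows "x \<le> y"
proof (rule ccontr)
  assume "\<not> x \<le> y"
  then have yx: "y < x" by simp
  then have y: "y < \<top>" using less_top_ennreal top.not_eq_extremum by (metis order.strict_trans2 top_greatest)
  have "y\<^sup>2 < x\<^sup>2"
  proof (cases "x = \<top>")
    case True
    with y show ?thesis by (simp add: power2_eq_square ennreal_mult_less_top)
  next
    case False
    then obtain a b where "x = ennreal a" "y = ennreal b" "0 \<le> a" "0 \<le> b"
      using y by (metis ennreal_enn2real_if enn2real_nonneg less_irrefl)
    with yx show ?thesis by (simp add: ennreal_power ennreal_less_iff power_strict_mono)
  qed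
  with assms show False by simp
qed

lemma ennreal_power2_eq_iff: "x\<^sup>2 = y\<^sup>2 \<longleftrightarrow> x = (y :: ennreal)"
  using ennreal_power2_le_imp_le by (metis order_antisym order_refl)

lemma epowr_half_eqI:
  assumes "y\<^sup>2 = x"
  shows "epowr x (1/2) = y"
  using epowr_half_square[of x] assms by (metis ennreal_power2_eq_iff)

lemma epowr_one: "epowr x 1 = x"
  by (cases x) (simp_all add: epowr_def)

lemma epowr_half_measurable: "(\<lambda>x. epowr x (1/2)) \<in> borel_measurable borel"
  unfolding epowr_def by measurable

text \<open>The Cauchy-Schwarz inequality, in a form that includes infinite integrals with the convention
  \<open>0 \<cdot> \<infinity> = 0\<close>.\<close>
lemma nn_integral_epowr_half_mult:
  assumes f [measurable]: "f \<in> borel_measurable M" and g [measurable]: "g \<in> borel_measurable M"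
  shows "(\<integral>\<^sup>+x. epowr (f x) (1/2) * epowr (g x) (1/2) \<partial>M)
    \<le> epowr (\<integral>\<^sup>+x. f x \<partial>M) (1/2) * epowr (\<integral>\<^sup>+x. g x \<partial>M) (1/2)"
proof (rule ennreal_power2_le_imp_le)
  have [measurable]: "(\<lambda>x. epowr (f x) (1/2)) \<in> borel_measurable M" "(\<lambda>x. epowr (g x) (1/2)) \<in> borel_measurable M"
    by (rule measurable_compose[OF _ epowr_half_measurable], measurable)+
  have "(\<integral>\<^sup>+x. epowr (f x) (1/2) * epowr (g x) (1/2) \<partial>M)\<^sup>2
      \<le> (\<integral>\<^sup>+x. (epowr (f x) (1/2))\<^sup>2 \<partial>M) * (\<integral>\<^sup>+x. (epowr (g x) (1/2))\<^sup>2 \<partial>M)"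
    by (rule Cauchy_Schwarz_nn_integral) measurable
  then show "(\<integral>\<^sup>+x. epowr (f x) (1/2) * epowr (g x) (1/2) \<partial>M)\<^sup>2
      \<le> (epowr (\<integral>\<^sup>+x. f x \<partial>M) (1/2) * epowr (\<integral>\<^sup>+x. g x \<partial>M) (1/2))\<^sup>2"
    by (simp add: power_mult_distrib epowr_half_square)
qed

lemma coupling_integral:
  fixes f :: "'a::second_countable_topology \<Rightarrow> 'b::{banach, second_countable_topology}"
  assumes P: "P \<in> couplings \<mu> \<eta>" and f: "f \<in> borel_measurable borel"
  shows "(\<integral>w. f (fst w) \<partial>P) = (\<integral>x. f x \<partial>\<mu>)" "(\<integral>w. f (snd w) \<partial>P) = (\<integral>x. f x \<partial>\<eta>)"
    and "integrable P (\<lambda>w. f (fst w)) \<longleftrightarrow> integrable \<mu> f" "integrable P (\<lambda>w. f (snd w)) \<longleftrightarrow> integrable \<eta> f"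
proof -
  note [measurable_cong] = couplingsD(2)[OF P]
  have m: "fst \<in> P \<rightarrow>\<^sub>M borel" "snd \<in> P \<rightarrow>\<^sub>M borel" by measurable
  show "(\<integral>w. f (fst w) \<partial>P) = (\<integral>x. f x \<partial>\<mu>)" "integrable P (\<lambda>w. f (fst w)) \<longleftrightarrow> integrable \<mu> f"
    using integral_distr[OF m(1) f] integrable_distr_eq[OF m(1) f] by (simp_all add: couplingsD(3)[OF P])
  show "(\<integral>w. f (snd w) \<partial>P) = (\<integral>x. f x \<partial>\<eta>)" "integrable P (\<lambda>w. f (snd w)) \<longleftrightarrow> integrable \<eta> f"
    using integral_distr[OF m(2) f] integrable_distr_eq[OF m(2) f] by (simp_all add: couplingsD(4)[OF P])
qed

lemma norm_integral_squared_le: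
  fixes X :: "'a \<Rightarrow> 'b::{banach, second_countable_topology}"
  assumes M: "prob_space M" and X [measurable]: "integrable M X"
  shows "ennreal ((norm (\<integral>w. X w \<partial>M))\<^sup>2) \<le> (\<integral>\<^sup>+w. ennreal ((norm (X w))\<^sup>2) \<partial>M)"
proof -
  interpret prob_space M by fact
  have [measurable]: "X \<in> borel_measurable M" using X by auto
  have "ennreal ((norm (\<integral>w. X w \<partial>M))\<^sup>2) = (ennreal (norm (\<integral>w. X w \<partial>M)))\<^sup>2"
    by (simp add: ennreal_power)
  also have "\<dots> \<le> (\<integral>\<^sup>+w. ennreal (norm (X w)) * 1 \<partial>M)\<^sup>2"
    using integral_norm_bound_ennreal[OF X] by (intro power_mono) simp_all
  also have "\<dots> \<le> (\<integral>\<^sup>+w. (ennreal (norm (X w)))\<^sup>2 \<partial>M) * (\<integral>\<^sup>+w. 1\<^sup>2 \<partial>M)"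
    by (rule Cauchy_Schwarz_nn_integral) measurable
  finally show ?thesis by (simp add: ennreal_power emeasure_space_1)
qed

lemma mean_diff_le_coupling:
  fixes A B :: "'a::euclidean_space measure"
  assumes P: "P \<in> couplings A B" and int: "integrable A (\<lambda>y. y)" "integrable B (\<lambda>y. y)"
  shows "ennreal ((norm ((\<integral>y. y \<partial>B) - (\<integral>y. y \<partial>A)))\<^sup>2) \<le> sq_cost P"
proof -
  have id: "(\<lambda>y::'a. y) \<in> borel_measurable borel" by simp
  note i = coupling_integral[OF P id]
  have iP: "integrable P fst" "integrable P snd" using int unfolding i(3,4)[symmetric] by simp_all
  have diff: "(\<integral>w. snd w - fst w \<partial>P) = (\<integral>y. y \<partial>B) - (\<integral>y. y \<partial>A)"
    unfolding i(1,2)[symmetric] by (rule Bochner_Integration.integral_diff[OF iP(2,1)])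
  have "integrable P (\<lambda>w. snd w - fst w)" using iP by simp
  from norm_integral_squared_le[OF couplingsD(1)[OF P] this]
  have "ennreal ((norm ((\<integral>y. y \<partial>B) - (\<integral>y. y \<partial>A)))\<^sup>2) \<le> (\<integral>\<^sup>+w. ennreal ((norm (snd w - fst w))\<^sup>2) \<partial>P)"
    unfolding diff .
  then show ?thesis by (simp add: case_prod_unfold norm_minus_commute)
qed

lemma mean_diff_le_D2:
  fixes A B :: "'a::euclidean_space measure"
  assumes int: "integrable A (\<lambda>y. y)" "integrable B (\<lambda>y. y)"
  shows "ennreal ((norm ((\<integral>y. y \<partial>B) - (\<integral>y. y \<partial>A)))\<^sup>2) \<le> (D2 A B)\<^sup>2"
  unfolding D2_squared by (intro INF_greatest mean_diff_le_coupling int)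

lemma integrable_second_moment:
  fixes A :: "'a::euclidean_space measure"
  assumes A: "is_prob A" and fin: "second_moment A < \<infinity>"
  shows "integrable A (\<lambda>y. y)" "integrable A (\<lambda>y. (norm (y - a))\<^sup>2)"
proof -
  interpret prob_space A by (rule is_probD[OF A])
  note [measurable_cong] = is_probD(2)[OF A]
  have 2: "integrable A (\<lambda>y. (norm y)\<^sup>2)" by (rule integrableI_nonneg) (use fin in auto)
  show 1: "integrable A (\<lambda>y. y)"
  proof (rule Bochner_Integration.integrable_bound)
    show "integrable A (\<lambda>y. 1 + (norm y)\<^sup>2)" using 2 by simp
    have "norm y \<le> 1 + (norm y)\<^sup>2" for y :: 'a
      using sum_squares_bound[of "norm y" 1] by simp (smt (verit) norm_ge_zero)
    then show "AE y in A. norm y \<le> norm (1 + (norm y)\<^sup>2)" by simp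
  qed simp
  show "integrable A (\<lambda>y. (norm (y - a))\<^sup>2)"
  proof (rule Bochner_Integration.integrable_bound)
    show "integrable A (\<lambda>y. 2 * (norm y)\<^sup>2 + 2 * (norm a)\<^sup>2)" using 2 by simp
    show "AE y in A. norm ((norm (y - a))\<^sup>2) \<le> norm (2 * (norm y)\<^sup>2 + 2 * (norm a)\<^sup>2)"
      using norm_diff_squared_le[of _ a] by simp
  qed simp
qed

lemma second_moment_if_centred_integrable:
  fixes A :: "'a::euclidean_space measure"
  assumes A: "is_prob A" and int: "integrable A (\<lambda>y. (norm (y - a))\<^sup>2)"
  shows "second_moment A < \<infinity>"
proof -
  interpret prob_space A by (rule is_probD[OF A])
  note [measurable_cong] = is_probD(2)[OF A]
  have c: "(\<integral>\<^sup>+y. ennreal ((norm (y - a))\<^sup>2) \<partial>A) < \<infinity>"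
    using int by (simp add: integrable_iff_bounded)
  have "second_moment A \<le> (\<integral>\<^sup>+y. 2 * ennreal ((norm (y - a))\<^sup>2) + 2 * ennreal ((norm a)\<^sup>2) \<partial>A)"
    using ennreal_norm_diff_squared_le[of "y - a" "- a" for y] by (intro nn_integral_mono) simp
  also have "\<dots> = 2 * (\<integral>\<^sup>+y. ennreal ((norm (y - a))\<^sup>2) \<partial>A) + 2 * ennreal ((norm a)\<^sup>2)"
    by (simp add: nn_integral_add nn_integral_cmult emeasure_space_1)
  also have "\<dots> < \<infinity>" using c by (simp add: ennreal_mult_less_top)
  finally show ?thesis .
qed

lemma norm_outer: "norm (outer v w) = norm v * norm w"
proof -
  have "(norm (outer v w))\<^sup>2 = (\<Sum>i\<in>UNIV. \<Sum>j\<in>UNIV. (v $ i)\<^sup>2 * (w $ j)\<^sup>2)"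
    by (simp add: outer_def norm_vec_def L2_set_def sum_nonneg power_mult_distrib)
  also have "\<dots> = (norm v)\<^sup>2 * (norm w)\<^sup>2"
    by (simp add: norm_vec_def L2_set_def sum_nonneg sum_product)
  finally show ?thesis
    by (metis norm_ge_zero power2_eq_imp_eq power_mult_distrib mult_nonneg_nonneg)
qed

lemma bounded_bilinear_outer: "bounded_bilinear (outer :: real^'d \<Rightarrow> real^'d \<Rightarrow> real^'d^'d)"
proof
  show "\<exists>K. \<forall>a b. norm (outer a b :: real^'d^'d) \<le> norm a * norm b * K"
    by (rule exI[of _ 1]) (simp add: norm_outer)
qed (auto simp: outer_def vec_eq_iff algebra_simps)

interpretation outer: bounded_bilinear "outer :: real^'d \<Rightarrow> real^'d \<Rightarrow> real^'d^'d"
  by (rule bounded_bilinear_outer)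

lemma outer_measurable [measurable (raw)]:
  fixes f g :: "'a \<Rightarrow> real^'d"
  assumes "f \<in> borel_measurable M" "g \<in> borel_measurable M"
  shows "(\<lambda>x. outer (f x) (g x)) \<in> borel_measurable M"
  by (rule borel_measurable_continuous_Pair[OF assms])
     (intro outer.continuous_on continuous_intros)

lemma bounded_linear_trace: "bounded_linear (trace :: real^'d^'d \<Rightarrow> real)"
proof -
  have "linear (trace :: real^'d^'d \<Rightarrow> real)"
    by (auto simp: linear_iff trace_def sum.distrib sum_distrib_left)
  then show ?thesis by (simp add: linear_conv_bounded_linear)
qed

lemma trace_outer: "trace (outer v v) = (norm v)\<^sup>2"
  by (simp add: trace_def outer_def norm_vec_def L2_set_def sum_nonneg power2_eq_square)

lemma trace_covariance:
  fixes A :: "(real^'d) measure"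
  assumes A: "is_prob A" and fin: "second_moment A < \<infinity>"
  shows "integrable A (\<lambda>y. outer (y - a) (y - a))"
    and "trace (\<integral>y. outer (y - a) (y - a) \<partial>A) = (\<integral>y. (norm (y - a))\<^sup>2 \<partial>A)"
proof -
  note [measurable_cong] = is_probD(2)[OF A]
  show int: "integrable A (\<lambda>y. outer (y - a) (y - a))"
    by (rule Bochner_Integration.integrable_bound[OF integrable_second_moment(2)[OF A fin, of a]])
       (simp_all add: norm_outer power2_eq_square)
  show "trace (\<integral>y. outer (y - a) (y - a) \<partial>A) = (\<integral>y. (norm (y - a))\<^sup>2 \<partial>A)"
    using integral_bounded_linear[OF bounded_linear_trace int] by (simp add: trace_outer)
qed

text \<open>With the centred variables \<open>U\<close> and \<open>V\<close> of the two margins and \<open>W = V - U\<close>, the difference of the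
  covariances is the expectation of \<open>WW' + UW' + WU'\<close>. Centring only lowers the cost: \<open>W\<close> is the
  centred version of \<open>Z = snd - fst\<close>, so \<open>E\<bar>W\<bar>\<^sup>2 = E\<bar>Z\<bar>\<^sup>2 - \<bar>E Z\<bar>\<^sup>2\<close>.\<close>
lemma covariance_diff_le_coupling:
  fixes A B :: "(real^'d) measure"
  assumes A: "is_prob A" and B: "is_prob B" and P: "P \<in> couplings A B"
    and fin: "second_moment A < \<infinity>" "second_moment B < \<infinity>" "sq_cost P < \<infinity>"
  defines "a \<equiv> \<integral>y. y \<partial>A" and "b \<equiv> \<integral>y. y \<partial>B"
  defines "S \<equiv> \<integral>y. outer (y - a) (y - a) \<partial>A" and "T \<equiv> \<integral>y. outer (y - b) (y - b) \<partial>B"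
  defines "C \<equiv> enn2real (sq_cost P)"
  shows "norm (T - S) \<le> C + 2 * sqrt (trace S * C)"
proof -
  interpret A: prob_space A by (rule is_probD[OF A])
  interpret B: prob_space B by (rule is_probD[OF B])
  interpret P: prob_space P by (rule couplingsD[OF P])
  note [measurable_cong] = is_probD(2)[OF A] is_probD(2)[OF B] couplingsD(2)[OF P]
  note iA = integrable_second_moment[OF A fin(1)] and iB = integrable_second_moment[OF B fin(2)]
  note oA = trace_covariance(1)[OF A fin(1), of a] and oB = trace_covariance(1)[OF B fin(2), of b]
  have trS: "trace S = (\<integral>y. (norm (y - a))\<^sup>2 \<partial>A)"
    unfolding S_def by (rule trace_covariance(2)[OF A fin(1)])
  define U where "U w = fst w - a" for w :: "(real^'d) \<times> (real^'d)"
  define V where "V w = snd w - b" for w :: "(real^'d) \<times> (real^'d)"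
  define Z where "Z w = snd w - fst w" for w :: "(real^'d) \<times> (real^'d)"
  define W where "W w = V w - U w" for w
  have [measurable]: "U \<in> borel_measurable P" "V \<in> borel_measurable P" "Z \<in> borel_measurable P" "W \<in> borel_measurable P"
    unfolding U_def[abs_def] V_def[abs_def] Z_def[abs_def] W_def[abs_def] by measurable
  have id: "(\<lambda>y::real^'d. y) \<in> borel_measurable borel" by simp
  note iid = coupling_integral[OF P id]
  have iP1: "integrable P fst" "integrable P snd"
    using iA(1) iB(1) unfolding iid(3,4)[symmetric] by simp_all
  have iZ: "integrable P Z" unfolding Z_def[abs_def] using iP1 by simp
  have mZ: "(\<integral>w. Z w \<partial>P) = b - a"
    unfolding Z_def a_def b_def iid(1,2)[symmetric]
    by (rule Bochner_Integration.integral_diff[OF iP1(2,1)])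
  have costZ: "sq_cost P = (\<integral>\<^sup>+w. ennreal ((norm (Z w))\<^sup>2) \<partial>P)"
    by (simp add: Z_def case_prod_unfold norm_minus_commute)
  have iZ2: "integrable P (\<lambda>w. (norm (Z w))\<^sup>2)"
    by (rule integrableI_nonneg) (use fin(3) costZ in auto)
  have C: "C = (\<integral>w. (norm (Z w))\<^sup>2 \<partial>P)"
    unfolding C_def costZ by (rule integral_eq_nn_integral[symmetric]) auto
  have WZ: "W w = Z w - (b - a)" for w by (simp add: W_def U_def V_def Z_def)
  have W2: "(norm (W w))\<^sup>2 = (norm (Z w))\<^sup>2 - 2 * (Z w \<bullet> (b - a)) + (norm (b - a))\<^sup>2" for w
    unfolding WZ power2_norm_eq_inner by (simp add: inner_diff_left inner_diff_right inner_commute)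
  have iW2: "integrable P (\<lambda>w. (norm (W w))\<^sup>2)"
    unfolding W2 using iZ iZ2 by simp
  have "(\<integral>w. (norm (W w))\<^sup>2 \<partial>P) = C - 2 * ((\<integral>w. Z w \<partial>P) \<bullet> (b - a)) + (norm (b - a))\<^sup>2"
    unfolding W2 using iZ iZ2 by (simp add: C P.prob_space)
  also have "\<dots> = C - (norm (b - a))\<^sup>2" by (simp add: mZ power2_norm_eq_inner)
  finally have W_le: "(\<integral>w. (norm (W w))\<^sup>2 \<partial>P) \<le> C" by simp
  have iU2: "integrable P (\<lambda>w. (norm (U w))\<^sup>2)" and U2: "(\<integral>w. (norm (U w))\<^sup>2 \<partial>P) = trace S"
    using coupling_integral(1,3)[OF P, of "\<lambda>y. (norm (y - a))\<^sup>2"] iA(2)[of a] by (simp_all add: U_def trS)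
  have iUW: "integrable P (\<lambda>w. norm (U w) * norm (W w))"
  proof (rule Bochner_Integration.integrable_bound)
    show "integrable P (\<lambda>w. (norm (U w))\<^sup>2 + (norm (W w))\<^sup>2)" using iU2 iW2 by simp
    have "norm (U w) * norm (W w) \<le> (norm (U w))\<^sup>2 + (norm (W w))\<^sup>2" for w
      using sum_squares_bound[of "norm (U w)" "norm (W w)"]
        mult_nonneg_nonneg[OF norm_ge_zero[of "U w"] norm_ge_zero[of "W w"]] by linarith
    then show "AE w in P. norm (norm (U w) * norm (W w)) \<le> norm ((norm (U w))\<^sup>2 + (norm (W w))\<^sup>2)"
      by simp
  qed simp
  have "ennreal ((\<integral>w. norm (U w) * norm (W w) \<partial>P)\<^sup>2) = (\<integral>\<^sup>+w. ennreal (norm (U w)) * ennreal (norm (W w)) \<partial>P)\<^sup>2"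
    using nn_integral_eq_integral[OF iUW] by (simp add: ennreal_power ennreal_mult)
  also have "\<dots> \<le> (\<integral>\<^sup>+w. (ennreal (norm (U w)))\<^sup>2 \<partial>P) * (\<integral>\<^sup>+w. (ennreal (norm (W w)))\<^sup>2 \<partial>P)"
    by (rule Cauchy_Schwarz_nn_integral) measurable
  also have "\<dots> = ennreal (trace S * (\<integral>w. (norm (W w))\<^sup>2 \<partial>P))"
    using nn_integral_eq_integral[OF iU2] nn_integral_eq_integral[OF iW2]
    by (simp add: ennreal_power U2 ennreal_mult flip: U2)
  finally have "(\<integral>w. norm (U w) * norm (W w) \<partial>P)\<^sup>2 \<le> trace S * (\<integral>w. (norm (W w))\<^sup>2 \<partial>P)"
    by (subst (asm) ennreal_le_iff) (auto simp flip: U2)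
  also have "\<dots> \<le> trace S * C" using W_le by (intro mult_left_mono) (auto simp flip: U2)
  finally have UW: "(\<integral>w. norm (U w) * norm (W w) \<partial>P) \<le> sqrt (trace S * C)"
    by (rule real_le_rsqrt)
  have expand: "outer (V w) (V w) - outer (U w) (U w)
      = outer (W w) (W w) + outer (U w) (W w) + outer (W w) (U w)" for w
    unfolding W_def by (simp add: outer.diff_left outer.diff_right)
  have iP: "integrable P (\<lambda>w. outer (U w) (U w))" "integrable P (\<lambda>w. outer (V w) (V w))"
    "(\<integral>w. outer (U w) (U w) \<partial>P) = S" "(\<integral>w. outer (V w) (V w) \<partial>P) = T"
    using coupling_integral(1,3)[OF P, of "\<lambda>y. outer (y - a) (y - a)"] oA
      coupling_integral(2,4)[OF P, of "\<lambda>y. outer (y - b) (y - b)"] oB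
    by (simp_all add: U_def V_def S_def T_def)
  have "T - S = (\<integral>w. outer (V w) (V w) - outer (U w) (U w) \<partial>P)"
    using iP by simp
  also have "norm \<dots> \<le> (\<integral>w. norm (outer (V w) (V w) - outer (U w) (U w)) \<partial>P)"
    by (rule integral_norm_bound)
  also have "\<dots> \<le> (\<integral>w. (norm (W w))\<^sup>2 + 2 * (norm (U w) * norm (W w)) \<partial>P)"
  proof (rule integral_mono)
    show "integrable P (\<lambda>w. norm (outer (V w) (V w) - outer (U w) (U w)))" using iP by simp
    show "integrable P (\<lambda>w. (norm (W w))\<^sup>2 + 2 * (norm (U w) * norm (W w)))" using iW2 iUW by simp
    fix w
    have "norm (outer (V w) (V w) - outer (U w) (U w))
        \<le> norm (outer (W w) (W w)) + norm (outer (U w) (W w)) + norm (outer (W w) (U w))"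
      unfolding expand by (intro norm_triangle_le add_right_mono norm_triangle_ineq)
    then show "norm (outer (V w) (V w) - outer (U w) (U w)) \<le> (norm (W w))\<^sup>2 + 2 * (norm (U w) * norm (W w))"
      by (simp add: norm_outer power2_eq_square mult.commute)
  qed
  also have "\<dots> = (\<integral>w. (norm (W w))\<^sup>2 \<partial>P) + 2 * (\<integral>w. norm (U w) * norm (W w) \<partial>P)"
    using iW2 iUW by simp
  also have "\<dots> \<le> C + 2 * sqrt (trace S * C)" using W_le UW by simp
  finally show ?thesis .
qed

text \<open>The bound of the previous lemma is continuous in the cost, so one may pass to the infimum over
  all couplings, and from there to any real upper bound \<open>G\<close> of it. The bound \<open>G\<close> is
  kept general because it will later be a measurable function of the base point.\<close>
lemma covariance_diff_le:
  fixes A B :: "(real^'d) measure"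
  assumes A: "is_prob A" and B: "is_prob B"
    and fin: "second_moment A < \<infinity>" "second_moment B < \<infinity>"
  defines "a \<equiv> \<integral>y. y \<partial>A" and "b \<equiv> \<integral>y. y \<partial>B"
  defines "S \<equiv> \<integral>y. outer (y - a) (y - a) \<partial>A" and "T \<equiv> \<integral>y. outer (y - b) (y - b) \<partial>B"
  assumes G: "(D2 A B)\<^sup>2 \<le> ennreal G" "G \<ge> 0"
  shows "norm (T - S) \<le> G + 2 * sqrt (trace S * G)"
proof (rule LIMSEQ_le_const)
  have tr: "trace S \<ge> 0"
    unfolding S_def trace_covariance(2)[OF A fin(1)] by (rule Bochner_Integration.integral_nonneg) simp
  have "(\<lambda>n. (G + 1 / real (Suc n)) + 2 * sqrt (trace S * (G + 1 / real (Suc n))))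
      \<longlonglongrightarrow> (G + 0) + 2 * sqrt (trace S * (G + 0))"
    by (intro tendsto_intros LIMSEQ_Suc[OF lim_1_over_n])
  then show "(\<lambda>n. (G + 1 / real (Suc n)) + 2 * sqrt (trace S * (G + 1 / real (Suc n))))
      \<longlonglongrightarrow> G + 2 * sqrt (trace S * G)" by simp
  have "norm (T - S) \<le> (G + 1 / real (Suc n)) + 2 * sqrt (trace S * (G + 1 / real (Suc n)))" for n
  proof -
    have "(D2 A B)\<^sup>2 < ennreal (G + 1 / real (Suc n))"
      using G by (elim le_less_trans) (simp add: ennreal_less_iff)
    then obtain P where P: "P \<in> couplings A B" and c: "sq_cost P < ennreal (G + 1 / real (Suc n))"
      unfolding D2_squared by (auto simp: INF_less_iff)
    have "sq_cost P < \<infinity>" using c by (rule less_trans) simp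
    from covariance_diff_le_coupling[OF A B P fin this]
    have "norm (T - S) \<le> enn2real (sq_cost P) + 2 * sqrt (trace S * enn2real (sq_cost P))"
      by (simp add: S_def T_def a_def b_def)
    moreover have "enn2real (sq_cost P) \<le> G + 1 / real (Suc n)"
      using c G by (intro enn2real_leI) auto
    moreover from this have "sqrt (trace S * enn2real (sq_cost P)) \<le> sqrt (trace S * (G + 1 / real (Suc n)))"
      using tr by (intro real_sqrt_le_mono mult_left_mono)
    ultimately show ?thesis by linarith
  qed
  then show "\<exists>N. \<forall>n\<ge>N. norm (T - S) \<le> (G + 1 / real (Suc n)) + 2 * sqrt (trace S * (G + 1 / real (Suc n)))"
    by blast
qed

section \<open>The transport, mean and covariance inequalities\<close>

lemma cond_mean_measurable:
  fixes K :: "real^'d \<Rightarrow> (real^'d) measure"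
  assumes K: "markov_transition K"
  shows "cond_mean K \<in> borel_measurable borel"
  unfolding cond_mean_def[abs_def]
  by (rule measurable_compose[OF measurable_prob_algebraD[OF K] integral_measurable_subprob_algebra]) simp

text \<open>The integrand depends on the base point through the conditional mean, so the integral is taken
  over pairs, against the kernel \<open>x \<mapsto> \<delta>\<^sub>x \<otimes> K x\<close>.\<close>
lemma cond_cov_measurable:
  fixes K :: "real^'d \<Rightarrow> (real^'d) measure"
  assumes K: "markov_transition K"
  shows "cond_cov K \<in> borel_measurable borel"
proof -
  note [measurable] = cond_mean_measurable[OF K]
  let ?g = "\<lambda>w. outer (snd w - cond_mean K (fst w)) (snd w - cond_mean K (fst w))"
  have g [measurable]: "?g \<in> borel_measurable (borel \<Otimes>\<^sub>M borel)" by measurable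
  have "(\<lambda>x. \<integral>w. ?g w \<partial>distr (K x) (borel \<Otimes>\<^sub>M borel) (Pair x)) \<in> borel_measurable borel"
    by (rule measurable_compose[OF measurable_prob_algebraD[OF kernel_prod_kernel[OF K]]
          integral_measurable_subprob_algebra[OF g]])
  moreover have "(\<integral>w. ?g w \<partial>distr (K x) (borel \<Otimes>\<^sub>M borel) (Pair x)) = cond_cov K x" for x
  proof -
    note [measurable_cong] = is_probD(2)[OF markov_transitionD[OF K, of x]]
    have "Pair x \<in> K x \<rightarrow>\<^sub>M borel \<Otimes>\<^sub>M borel" by measurable
    then show ?thesis by (subst integral_distr[OF _ g]) (simp_all add: cond_cov_def)
  qed
  ultimately show ?thesis by simp
qed

lemma second_moment_if_cov_well_defined:
  fixes L :: "real^'d \<Rightarrow> (real^'d) measure"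
  assumes L: "is_prob (L x)" and wd: "cov_well_defined L x"
  shows "second_moment (L x) < \<infinity>"
proof -
  have "integrable (L x) (\<lambda>y. trace (outer (y - cond_mean L x) (y - cond_mean L x)))"
    by (rule integrable_bounded_linear[OF bounded_linear_trace wd[unfolded cov_well_defined_def]])
  then show ?thesis
    unfolding trace_outer by (rule second_moment_if_centred_integrable[OF L])
qed

theorem theorem1p1:
  fixes \<rho> :: real
    and K L :: "real^'d \<Rightarrow> (real^'d) measure"
    and \<mu> :: "(real^'d) measure"
  assumes "\<rho> > 0"
    and "markov_transition K"
    and "kernel_T2 \<rho> K"
    and "is_prob \<mu>"
    and "markov_transition L"
  shows "(D2 (\<mu> \<bind> L) (\<mu> \<bind> K))\<^sup>2 \<le> (\<integral>\<^sup>+x. (D2 (L x) (K x))\<^sup>2 \<partial>\<mu>)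
    \<and> (\<integral>\<^sup>+x. (D2 (L x) (K x))\<^sup>2 \<partial>\<mu>)
        \<le> 2 * ennreal \<rho> * rel_entropy (kernel_prod \<mu> L) (kernel_prod \<mu> K)
    \<and> ((AE x in \<mu>. mean_well_defined L x) \<longrightarrow>
        (Lp_norm 2 \<mu> (\<lambda>x. cond_mean K x - cond_mean L x))\<^sup>2
          \<le> 2 * ennreal \<rho> * rel_entropy (kernel_prod \<mu> L) (kernel_prod \<mu> K))
    \<and> ((AE x in \<mu>. mean_well_defined L x \<and> cov_well_defined L x) \<longrightarrow>
        Lp_norm 1 \<mu> (\<lambda>x. cond_cov K x - cond_cov L x)
          \<le> 4 * ennreal \<rho> * rel_entropy (kernel_prod \<mu> L) (kernel_prod \<mu> K)
            + c_const \<mu> L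
              * epowr (8 * ennreal \<rho> * rel_entropy (kernel_prod \<mu> L) (kernel_prod \<mu> K)) (1/2))"
proof -
  note rho = assms(1) and K = assms(2) and mu = assms(4) and L = assms(5)
  have T2: "transport_T2 \<rho> (K x)" for x using assms(3) by (simp add: kernel_T2_def)
  note Kx = markov_transitionD[OF K] and Lx = markov_transitionD[OF L]
  note [measurable_cong] = is_probD(2)[OF mu]
  let ?H = "rel_entropy (kernel_prod \<mu> L) (kernel_prod \<mu> K)"
  have K2: "second_moment (K x) < \<infinity>" for x
    by (rule transport_T2_second_moment[OF T2 Kx])
  note Kint = integrable_second_moment(1)[OF Kx K2]
  have D2_entropy: "(D2 (L x) (K x))\<^sup>2 \<le> 2 * ennreal \<rho> * rel_entropy (L x) (K x)" for x
  proof -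
    have "(D2 (L x) (K x))\<^sup>2 = 2 * ((D2 (L x) (K x))\<^sup>2 / 2)"
      by (simp add: ennreal_times_divide ennreal_mult_divide_eq mult.commute[of 2])
    also have "\<dots> \<le> 2 * (ennreal \<rho> * rel_entropy (L x) (K x))"
      using T2[of x] Lx[of x] unfolding transport_T2_def by (intro mult_left_mono) auto
    finally show ?thesis by (simp add: mult.assoc)
  qed
  \<comment> \<open>A measurable majorant \<open>h\<close> of the fibrewise transport cost with the right integral. The last
    inequality needs it because Cauchy-Schwarz is applied in the base point.\<close>
  have bound: "?H = \<infinity> \<or> (\<exists>h. h \<in> borel_measurable borel \<and> (AE x in \<mu>. (D2 (L x) (K x))\<^sup>2 \<le> h x)
      \<and> (\<integral>\<^sup>+x. h x \<partial>\<mu>) = 2 * ennreal \<rho> * ?H)"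
  proof (cases "?H = \<infinity>")
    case False
    obtain h where h: "h \<in> borel_measurable borel" "AE x in \<mu>. rel_entropy (L x) (K x) = h x"
      "(\<integral>\<^sup>+x. h x \<partial>\<mu>) = ?H"
      by (rule rel_entropy_chain_rule[OF mu K L False])
    note [measurable] = h(1)
    have "AE x in \<mu>. (D2 (L x) (K x))\<^sup>2 \<le> 2 * ennreal \<rho> * h x"
      using h(2) by eventually_elim (use D2_entropy in metis)
    moreover have "(\<integral>\<^sup>+x. 2 * ennreal \<rho> * h x \<partial>\<mu>) = 2 * ennreal \<rho> * ?H"
      by (subst nn_integral_cmult) (simp_all add: h(3))
    moreover have "(\<lambda>x. 2 * ennreal \<rho> * h x) \<in> borel_measurable borel" by measurable
    ultimately show ?thesis by blast
  qed simp
  have top: "2 * ennreal \<rho> * ?H = \<infinity>" if "?H = \<infinity>"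
    using rho by (simp add: that ennreal_mult_top)
  have first: "(D2 (\<mu> \<bind> L) (\<mu> \<bind> K))\<^sup>2 \<le> (\<integral>\<^sup>+x. (D2 (L x) (K x))\<^sup>2 \<partial>\<mu>)"
    by (rule D2_bind_le[OF mu L K K2])
  have second: "(\<integral>\<^sup>+x. (D2 (L x) (K x))\<^sup>2 \<partial>\<mu>) \<le> 2 * ennreal \<rho> * ?H"
    using bound
  proof
    assume "\<exists>h. h \<in> borel_measurable borel \<and> (AE x in \<mu>. (D2 (L x) (K x))\<^sup>2 \<le> h x)
      \<and> (\<integral>\<^sup>+x. h x \<partial>\<mu>) = 2 * ennreal \<rho> * ?H"
    then obtain h where h: "AE x in \<mu>. (D2 (L x) (K x))\<^sup>2 \<le> h x" "(\<integral>\<^sup>+x. h x \<partial>\<mu>) = 2 * ennreal \<rho> * ?H"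
      by blast
    show ?thesis unfolding h(2)[symmetric] by (rule nn_integral_mono_AE[OF h(1)])
  next
    assume "?H = \<infinity>"
    then show ?thesis by (subst top) simp_all
  qed
  have third: "(Lp_norm 2 \<mu> (\<lambda>x. cond_mean K x - cond_mean L x))\<^sup>2 \<le> 2 * ennreal \<rho> * ?H"
    if wd: "AE x in \<mu>. mean_well_defined L x"
  proof -
    have "(Lp_norm 2 \<mu> (\<lambda>x. cond_mean K x - cond_mean L x))\<^sup>2
        = (\<integral>\<^sup>+x. ennreal ((norm (cond_mean K x - cond_mean L x))\<^sup>2) \<partial>\<mu>)"
      unfolding Lp_norm_def epowr_half_square by simp
    also have "\<dots> \<le> (\<integral>\<^sup>+x. (D2 (L x) (K x))\<^sup>2 \<partial>\<mu>)"
      using wd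
    proof (intro nn_integral_mono_AE, eventually_elim)
      case (elim x)
      then show ?case
        using mean_diff_le_D2[of "L x" "K x"] Kint[of x] by (simp add: cond_mean_def mean_well_defined_def)
    qed
    finally show ?thesis using second by (rule order_trans)
  qed
  have fourth: "Lp_norm 1 \<mu> (\<lambda>x. cond_cov K x - cond_cov L x)
      \<le> 4 * ennreal \<rho> * ?H + c_const \<mu> L * epowr (8 * ennreal \<rho> * ?H) (1/2)"
    if wd: "AE x in \<mu>. mean_well_defined L x \<and> cov_well_defined L x"
    using bound
  proof
    assume "?H = \<infinity>"
    then have "4 * ennreal \<rho> * ?H = \<infinity>" using rho by (simp add: ennreal_mult_top)
    then show ?thesis by simp
  next
    assume "\<exists>h. h \<in> borel_measurable borel \<and> (AE x in \<mu>. (D2 (L x) (K x))\<^sup>2 \<le> h x)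
      \<and> (\<integral>\<^sup>+x. h x \<partial>\<mu>) = 2 * ennreal \<rho> * ?H"
    then obtain h where h [measurable]: "h \<in> borel_measurable borel"
      and hD: "AE x in \<mu>. (D2 (L x) (K x))\<^sup>2 \<le> h x" and hH: "(\<integral>\<^sup>+x. h x \<partial>\<mu>) = 2 * ennreal \<rho> * ?H"
      by blast
    \<comment> \<open>The square of \<^const>\<open>c_const\<close> is the integral of \<open>t\<close>.\<close>
    define t where "t x = ennreal (trace (cond_cov L x))" for x
    have t [measurable]: "t \<in> borel_measurable borel"
      unfolding t_def
      by (intro measurable_compose[OF _ measurable_ennreal] measurable_compose[OF cond_cov_measurable[OF L]]
          borel_measurable_continuous_onI bounded_linear.continuous_on[OF bounded_linear_trace] continuous_on_id)
    have "AE x in \<mu>. ennreal (norm (cond_cov K x - cond_cov L x))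
        \<le> h x + 2 * (epowr (t x) (1/2) * epowr (h x) (1/2))"
      using wd hD
    proof eventually_elim
      case (elim x)
      then have wdx: "cov_well_defined L x" by simp
      note L2 = second_moment_if_cov_well_defined[where L=L, OF Lx wdx]
      have tr: "trace (cond_cov L x) \<ge> 0"
        unfolding cond_cov_def trace_covariance(2)[OF Lx L2]
        by (rule Bochner_Integration.integral_nonneg) simp
      show ?case
      proof (cases "h x = \<infinity>")
        case False
        then obtain g where g: "h x = ennreal g" "g \<ge> 0" by (cases "h x") auto
        have "(D2 (L x) (K x))\<^sup>2 \<le> ennreal g" using elim g by simp
        from covariance_diff_le[OF Lx Kx L2 K2 this g(2)]
        have "norm (cond_cov K x - cond_cov L x) \<le> g + 2 * sqrt (trace (cond_cov L x) * g)"
          by (simp add: cond_cov_def cond_mean_def)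
        then have "ennreal (norm (cond_cov K x - cond_cov L x))
            \<le> ennreal (g + 2 * (sqrt (trace (cond_cov L x)) * sqrt g))"
          by (intro ennreal_leI) (simp add: real_sqrt_mult)
        also have "\<dots> = ennreal g + 2 * (ennreal (sqrt (trace (cond_cov L x))) * ennreal (sqrt g))"
          using g(2) tr by (simp add: ennreal_mult)
        also have "ennreal (sqrt (trace (cond_cov L x))) = epowr (t x) (1/2)"
          unfolding t_def using tr by (intro epowr_half_eqI[symmetric]) (simp add: ennreal_power)
        also have "ennreal (sqrt g) = epowr (h x) (1/2)"
          using g by (intro epowr_half_eqI[symmetric]) (simp add: ennreal_power)
        finally show ?thesis by (simp add: g)
      qed simp
    qed
    then have "(\<integral>\<^sup>+x. ennreal (norm (cond_cov K x - cond_cov L x)) \<partial>\<mu>)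
        \<le> (\<integral>\<^sup>+x. h x + 2 * (epowr (t x) (1/2) * epowr (h x) (1/2)) \<partial>\<mu>)"
      by (rule nn_integral_mono_AE)
    also have "\<dots> = (\<integral>\<^sup>+x. h x \<partial>\<mu>) + 2 * (\<integral>\<^sup>+x. epowr (t x) (1/2) * epowr (h x) (1/2) \<partial>\<mu>)"
    proof -
      have [measurable]: "(\<lambda>x. epowr (t x) (1/2)) \<in> borel_measurable \<mu>" "(\<lambda>x. epowr (h x) (1/2)) \<in> borel_measurable \<mu>"
        by (rule measurable_compose[OF _ epowr_half_measurable], measurable)+
      show ?thesis by (simp add: nn_integral_add nn_integral_cmult)
    qed
    also have "\<dots> \<le> 2 * ennreal \<rho> * ?H + 2 * (c_const \<mu> L * epowr (2 * ennreal \<rho> * ?H) (1/2))"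
      unfolding hH[symmetric] c_const_def t_def[symmetric]
      by (intro add_left_mono mult_left_mono nn_integral_epowr_half_mult) simp_all
    also have "\<dots> = 2 * ennreal \<rho> * ?H + c_const \<mu> L * epowr (8 * ennreal \<rho> * ?H) (1/2)"
    proof -
      have "(2 * epowr (2 * ennreal \<rho> * ?H) (1/2))\<^sup>2 = 4 * (2 * ennreal \<rho> * ?H)"
        unfolding power_mult_distrib epowr_half_square by simp
      also have "\<dots> = 8 * ennreal \<rho> * ?H" by (simp add: mult.assoc[symmetric])
      finally have "epowr (8 * ennreal \<rho> * ?H) (1/2) = 2 * epowr (2 * ennreal \<rho> * ?H) (1/2)"
        by (rule epowr_half_eqI)
      then show ?thesis by (simp add: mult_ac)
    qed
    also have "\<dots> \<le> 4 * ennreal \<rho> * ?H + c_const \<mu> L * epowr (8 * ennreal \<rho> * ?H) (1/2)"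
      by (intro add_right_mono mult_right_mono) auto
    finally show ?thesis by (simp add: Lp_norm_def epowr_one)
  qed
  from first second third fourth show ?thesis by blast
qed

end
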